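(* Consider the TSP instance $G_1$ on $V=\{1,\dots,n\}$ with $d(\{i,i+1\})=1$ for $i=1,\dots,n-1$, $d(\{n,1\})=1$, and $d(e)=n$ for all other edges; its unique optimal Hamiltonian cycle is $s^*=(1,2,\dots,n)$. Run the cross-entropy algorithm described in the context (with $M=1$, $\rho=1$, $\pi_{\min}=\frac{1}{n(n-2)}$, $\pi_{\max}=1-\frac1n$) with the edge-based random solution generation and a sample size $N<\frac{1}{220}\ln n$. Then, with probability $1-e^{-\Omega(n^{1/200})}$ (as $n\to\infty$), the algorithm does not find $s^*$ within $e^{\Theta(n^{1/300})}$ iterations.
   Context: Let $K_n$ be the complete graph on $V=\{1,\dots,n\}$. A feasible solution is a Hamiltonian cycle; its cost is the sum of $d$ over its edges. For a Hamiltonian cycle $H$, let $\Pi^H=(\pi_{i,j})$ be the symmetric matrix with $\pi_{i,i}=0$, $\pi_{i,j}=1-\frac1n$ if $\{i,j\}\in H$ and $\pi_{i,j}=\frac{1}{n(n-2)}$ otherwise. Edge-based generation from $\Pi$: starting from $B=\emptyset$, repeatedly add an edge $\{i,j\}\notin B$ chosen among admissible edges with probability proportional to $\pi_{i,j}+\pi_{j,i}$ until $B$ is a Hamiltonian cycle; an edge is admissible if adding it to $B$ creates no vertex of degree $\ge3$ and no cycle with fewer than $n$ edges. The algorithm: $\Pi_0$ has all off-diagonal entries $\frac1{n-1}$; in iteration $t=0,1,\dots$ generate $N$ independent solutions from $\Pi_t$, let $X_t^{[1]}$ be one of minimum cost, and set $\Pi_{t+1}=\Pi^{X_t^{[1]}}$.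 The optimal solution is found within $T$ iterations if some $X_t^{[1]}$, $t\le T$, is optimal. *)

theory Defs
  imports "HOL-Probability.Probability"
begin

definition verts :: "nat \<Rightarrow> nat set" where
  "verts n = {1..n}"

definition kn_edges :: "nat \<Rightarrow> nat set set" where
  "kn_edges n = {{i, j} | i j. i \<in> verts n \<and> j \<in> verts n \<and> i \<noteq> j}"

definition ham_cycle :: "nat \<Rightarrow> nat set set \<Rightarrow> bool" where
  "ham_cycle n H \<longleftrightarrow> (\<exists>p. bij_betw p {..<n} (verts n) \<and>
      H = {{p i, p ((i + 1) mod n)} | i. i < n})"

definition cost :: "(nat set \<Rightarrow> real) \<Rightarrow> nat set set \<Rightarrow> real" where
  "cost d H = (\<Sum>e\<in>H. d e)"

definition has_cycle_len :: "nat \<Rightarrow> nat set set \<Rightarrow> nat \<Rightarrow> bool" where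
  "has_cycle_len n B k \<longleftrightarrow> 3 \<le> k \<and> (\<exists>p. inj_on p {..<k} \<and> p ` {..<k} \<subseteq> verts n \<and>
      (\<forall>i<k. {p i, p ((i + 1) mod k)} \<in> B))"

definition degree :: "nat set set \<Rightarrow> nat \<Rightarrow> nat" where
  "degree B v = card {e \<in> B. v \<in> e}"

definition admissible :: "nat \<Rightarrow> nat set set \<Rightarrow> nat set set" where
  "admissible n B = {e \<in> kn_edges n. e \<notin> B \<and>
      (\<forall>v \<in> verts n. degree (insert e B) v < 3) \<and>
      (\<forall>k. k < n \<longrightarrow> \<not> has_cycle_len n (insert e B) k)}"

definition edge_weight :: "(nat \<Rightarrow> nat \<Rightarrow> real) \<Rightarrow> nat set \<Rightarrow> real" where
  "edge_weight P e = P (Min e) (Max e) + P (Max e) (Min e)"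

definition weighted_pmf :: "'a set \<Rightarrow> ('a \<Rightarrow> real) \<Rightarrow> 'a pmf" where
  "weighted_pmf A w = embed_pmf (\<lambda>x. if x \<in> A then w x / (\<Sum>y\<in>A. w y) else 0)"

primrec gen_steps :: "nat \<Rightarrow> (nat \<Rightarrow> nat \<Rightarrow> real) \<Rightarrow> nat \<Rightarrow> nat set set \<Rightarrow> nat set set pmf" where
  "gen_steps n P 0 B = return_pmf B"
| "gen_steps n P (Suc k) B =
     (if ham_cycle n B then return_pmf B
      else bind_pmf (weighted_pmf (admissible n B) (edge_weight P))
             (\<lambda>e. gen_steps n P k (insert e B)))"

text \<open>Starting from the empty set, exactly n edges are added until B is a Hamiltonian cycle.\<close>
definition generate :: "nat \<Rightarrow> (nat \<Rightarrow> nat \<Rightarrow> real) \<Rightarrow> nat set set pmf" where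
  "generate n P = gen_steps n P n {}"

definition Pi0 :: "nat \<Rightarrow> nat \<Rightarrow> nat \<Rightarrow> real" where
  "Pi0 n i j = (if i = j then 0 else 1 / (real n - 1))"

definition PiH :: "nat \<Rightarrow> nat set set \<Rightarrow> nat \<Rightarrow> nat \<Rightarrow> real" where
  "PiH n H i j = (if i = j then 0 else if {i, j} \<in> H then 1 - 1 / real n
                   else 1 / (real n * (real n - 2)))"

primrec samples :: "nat \<Rightarrow> 'a pmf \<Rightarrow> 'a list pmf" where
  "samples 0 p = return_pmf []"
| "samples (Suc N) p = bind_pmf p (\<lambda>x. bind_pmf (samples N p) (\<lambda>xs. return_pmf (x # xs)))"

definition best :: "(nat set \<Rightarrow> real) \<Rightarrow> nat set set list \<Rightarrow> nat set set" where
  "best d xs = hd (filter (\<lambda>x. cost d x = Min (cost d ` set xs)) xs)"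

definition iter_best :: "nat \<Rightarrow> nat \<Rightarrow> (nat set \<Rightarrow> real) \<Rightarrow> (nat \<Rightarrow> nat \<Rightarrow> real) \<Rightarrow> nat set set pmf" where
  "iter_best n N d P = map_pmf (best d) (samples N (generate n P))"

text \<open>found_from n N d s T P: starting the current iteration with matrix P, the solution s
  is among the best solutions X_t of this and the following T iterations.\<close>
primrec found_from :: "nat \<Rightarrow> nat \<Rightarrow> (nat set \<Rightarrow> real) \<Rightarrow> nat set set \<Rightarrow> nat
    \<Rightarrow> (nat \<Rightarrow> nat \<Rightarrow> real) \<Rightarrow> bool pmf" where
  "found_from n N d s 0 P = map_pmf (\<lambda>X. X = s) (iter_best n N d P)"
| "found_from n N d s (Suc T) P = bind_pmf (iter_best n N d P)
     (\<lambda>X. if X = s then return_pmf True else found_from n N d s T (PiH n X))"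

definition found_within :: "nat \<Rightarrow> nat \<Rightarrow> (nat set \<Rightarrow> real) \<Rightarrow> nat set set \<Rightarrow> nat \<Rightarrow> bool pmf" where
  "found_within n N d s T = found_from n N d s T (Pi0 n)"

definition s_star :: "nat \<Rightarrow> nat set set" where
  "s_star n = {{i, i + 1} | i. 1 \<le> i \<and> i < n} \<union> {{n, 1}}"

definition G1 :: "nat \<Rightarrow> nat set \<Rightarrow> real" where
  "G1 n e = (if e \<in> s_star n then 1 else real n)"

end

(* Let k(H) be the number of edges of s* missing from H, and use exp (- l k) as a potential.

   Whatever the current tour H is, a sampled tour X differs from H in more than 9L edges with
   probability O(2^-L): after d foreign edges have been inserted, at least r - 4d edges of H are
   admissible when r steps remain, so foreign edges stay rare until r <= 8d.  The distribution of X
   is invariant under the rotations of H, hence every fixed edge is inserted or lost with probability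
   at most 4 E|X - H| / n.  For k(H) small compared with n, X therefore agrees w.h.p. with H
   on the symmetric difference of H and s*; it then loses an edge of s* unless X = H, and X = H has
   probability bounded away from 1.  With N < ln n / 220 samples, all of them lose an edge of s* with
   probability at least n^(-1/20), which outweighs the probability of any progress.  Hence the potential
   is a supermartingale up to an error exp (- Omega(n^(1/100))), it starts that small since a
   uniform sample shares few edges with s*, and it equals 1 at s*. *)
theory Submission
  imports Defs "HOL-Real_Asymp.Real_Asymp"
begin

section \<open>Hamiltonian cycles and path systems\<close>

text \<open>One iteration may change many edges at once, so k(H) moves by jumps rather than unit
  steps; the scales are chosen for that. With \<open>l = 1 / (9 * L)\<close> a jump of at most 9L
  edges multiplies the potential by at most e, while the loss of one edge still lowers it by the
  factor exp (- l), a relative gain of order 1/L. With \<open>K = 9 * L + 9 * L^2\<close> one has l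
  (K - 9L) = L, so tours with k > K contribute at most exp (- L) even after a jump. For L about
  n^(1/100), K is of order n^(1/50), and the chance that a sample moves any of the 2k edges of the
  symmetric difference is of order n^(-97/100), far below n^(-1/20)/L. The constant 220 arises as 20
  * 11: a single sample loses an edge with probability at least 1/33 - 1/132 = 1/44 >= exp (- 11),
  and exp (- 11) to the power (ln n)/220 is n^(-1/20). The step bounds control only the number of
  foreign edges, and only until few paths remain; they say nothing about one given edge. That is why
  symmetry is brought in.\<close>

fun path_edges :: "'a list \<Rightarrow> 'a set set" where
  "path_edges (x # y # zs) = insert {x, y} (path_edges (y # zs))"
| "path_edges _ = {}"

lemma path_edges_nth: "path_edges xs = {{xs ! i, xs ! Suc i} | i. Suc i < length xs}"
proof (induction xs rule: path_edges.induct)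
  case (1 x y zs)
  have "{{(x # y # zs) ! i, (x # y # zs) ! Suc i} | i. Suc i < length (x # y # zs)}
     = insert {x, y} {{(y # zs) ! i, (y # zs) ! Suc i} | i. Suc i < length (y # zs)}" (is "?L = ?R")
  proof
    show "?L \<subseteq> ?R"
    proof
      fix e assume "e \<in> ?L"
      then obtain i where i: "e = {(x # y # zs) ! i, (x # y # zs) ! Suc i}"
        "Suc i < length (x # y # zs)" by blast
      then show "e \<in> ?R" by (cases i) auto
    qed
    show "?R \<subseteq> ?L"
    proof
      fix e assume "e \<in> ?R"
      then consider "e = {x, y}"
        | i where "e = {(y # zs) ! i, (y # zs) ! Suc i}" "Suc i < length (y # zs)" by blast
      then show "e \<in> ?L"
      proof cases
        case 1
        then show ?thesis by (auto intro!: exI[of _ 0])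
      next
        case (2 i)
        then show ?thesis by (auto intro!: exI[of _ "Suc i"])
      qed
    qed
  qed
  with 1 show ?case by simp
qed auto

lemma path_edges_append:
  assumes "xs \<noteq> []" "ys \<noteq> []"
  shows "path_edges (xs @ ys) = insert {last xs, hd ys} (path_edges xs \<union> path_edges ys)"
  using assms
proof (induction xs rule: path_edges.induct)
  case ("2_2" v)
  then show ?case by (cases ys) auto
qed auto

lemma path_edges_rev [simp]: "path_edges (rev xs) = path_edges xs"
proof (induction xs)
  case (Cons x xs)
  show ?case
  proof (cases "xs = []")
    case False
    then obtain y ys where "xs = y # ys" by (cases xs) auto
    have "path_edges (rev xs @ [x]) = insert {last (rev xs), x} (path_edges xs)"
      using path_edges_append[of "rev xs" "[x]"] False Cons by simp
    then show ?thesis using \<open>xs = y # ys\<close> by (auto simp: insert_commute)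
  qed simp
qed simp

lemma path_edges_subset: "e \<in> path_edges xs \<Longrightarrow> e \<subseteq> set xs"
  by (auto simp: path_edges_nth)

lemma path_edges_nonempty: "e \<in> path_edges xs \<Longrightarrow> e \<noteq> {}"
  by (auto simp: path_edges_nth)

lemma finite_path_edges [simp]: "finite (path_edges xs)"
  by (induction xs rule: path_edges.induct) auto

lemma degree_insert: "finite B \<Longrightarrow> e \<notin> B \<Longrightarrow> v \<in> e \<Longrightarrow> degree (insert e B) v = Suc (degree B v)"
proof -
  assume *: "finite B" "e \<notin> B" "v \<in> e"
  have "{f \<in> insert e B. v \<in> f} = insert e {f \<in> B. v \<in> f}" using * by auto
  then show ?thesis unfolding degree_def using * by simp
qed

lemma finite_verts [simp]: "finite (verts n)" and card_verts [simp]: "card (verts n) = n"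
  by (auto simp: verts_def)

lemma finite_kn_edges [simp]: "finite (kn_edges n)"
  by (rule finite_subset[of _ "Pow (verts n)"]) (auto simp: kn_edges_def)

lemma finite_admissible [simp]: "finite (admissible n B)"
  by (rule finite_subset[of _ "kn_edges n"]) (auto simp: admissible_def)

lemma mod_pred_Suc: "i < (k::nat) \<Longrightarrow> (((i + k - 1) mod k) + 1) mod k = i"
  by (cases i) (auto simp: mod_Suc_eq)

lemma Suc_mod_eq: "i < n \<Longrightarrow> (i + 1) mod n = (if i + 1 = n then 0 else i + (1::nat))"
  by auto

text \<open>False for n = 2, where 0 and 1 succeed each other. Through this fact
  \<open>3 \<le> n\<close> makes the n edges of a tour distinct.\<close>

lemma no_mutual_successors:
  assumes "i < n" "j < n" "3 \<le> (n::nat)" "i = (j + 1) mod n" "j = (i + 1) mod n"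
  shows False
proof -
  have i: "i + 1 = n \<and> j = 0 \<or> j = i + 1" using Suc_mod_eq[OF assms(1)] assms(5) by argo
  have j: "j + 1 = n \<and> i = 0 \<or> i = j + 1" using Suc_mod_eq[OF assms(2)] assms(4) by argo
  show False using i j assms(3) by linarith
qed

lemma mod_pred_neq_Suc: "i < (k::nat) \<Longrightarrow> 3 \<le> k \<Longrightarrow> (i + k - 1) mod k \<noteq> (i + 1) mod k"
  by (cases i) (simp_all add: mod_Suc)

section \<open>Tours as cyclic enumerations of the vertices\<close>

locale ham =
  fixes n :: nat and h :: "nat \<Rightarrow> nat" and H :: "nat set set"
  assumes n3: "3 \<le> n"
    and bij: "bij_betw h {..<n} (verts n)"
    and H_eq: "H = {{h i, h ((i + 1) mod n)} | i. i < n}"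
begin

lemma h_inj: "i < n \<Longrightarrow> j < n \<Longrightarrow> h i = h j \<longleftrightarrow> i = j"
  using bij by (auto simp: bij_betw_def inj_on_def)

lemma h_verts: "i < n \<Longrightarrow> h i \<in> verts n"
  using bij by (auto simp: bij_betw_def)

lemma h_surj: "v \<in> verts n \<Longrightarrow> \<exists>i<n. v = h i"
  using bij by (auto simp: bij_betw_def)

lemma ham_cycle: "ham_cycle n H"
  unfolding ham_cycle_def using bij H_eq by blast

lemma H_image: "H = (\<lambda>i. {h i, h ((i + 1) mod n)}) ` {..<n}"
  using H_eq by auto

lemma finite_H: "finite H" by (simp add: H_image)

lemma mod_lt: "i mod n < n" using n3 by simp

lemma edge_index_inj:
  assumes "i < n" "j < n" "{h i, h ((i + 1) mod n)} = {h j, h ((j + 1) mod n)}"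
  shows "i = j"
proof (rule ccontr)
  assume "i \<noteq> j"
  then have "h i = h ((j + 1) mod n)" "h j = h ((i + 1) mod n)"
    using assms h_inj[of i j] by (auto simp: doubleton_eq_iff)
  then have "i = (j + 1) mod n" "j = (i + 1) mod n"
    using assms h_inj mod_lt by metis+
  with no_mutual_successors[OF assms(1,2) n3] show False by blast
qed

lemma card_H: "card H = n"
proof -
  have "inj_on (\<lambda>i. {h i, h ((i + 1) mod n)}) {..<n}"
    using edge_index_inj by (auto simp: inj_on_def simp del: One_nat_def)
  then show ?thesis by (simp add: H_image card_image)
qed

lemma H_subset: "H \<subseteq> kn_edges n"
proof
  fix e assume "e \<in> H"
  then obtain i where i: "i < n" "e = {h i, h ((i + 1) mod n)}" using H_eq by blast
  have "i \<noteq> (i + 1) mod n" using i n3 by (cases "i + 1 = n") auto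
  then have "h i \<noteq> h ((i + 1) mod n)" using h_inj i mod_lt by blast
  then show "e \<in> kn_edges n" using i h_verts mod_lt unfolding kn_edges_def by blast
qed

lemma neighbours:
  assumes "{h i, h j} \<in> H" "i < n" "j < n"
  shows "j = (i + 1) mod n \<or> i = (j + 1) mod n"
proof -
  obtain m where m: "m < n" "{h i, h j} = {h m, h ((m + 1) mod n)}" using assms H_eq by blast
  then consider "h i = h m" "h j = h ((m + 1) mod n)" | "h j = h m" "h i = h ((m + 1) mod n)"
    by (auto simp: doubleton_eq_iff)
  then show ?thesis using h_inj assms m mod_lt by cases metis+
qed

lemma degree_H_le: "degree H v \<le> 2"
proof (cases "\<exists>e\<in>H. v \<in> e")
  case True
  then have "v \<in> verts n" using H_subset by (auto simp: kn_edges_def)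
  then obtain i where i: "i < n" "v = h i" using h_surj by blast
  have "{e \<in> H. v \<in> e} \<subseteq> {{h i, h ((i + 1) mod n)}, {h ((i + n - 1) mod n), h i}}"
  proof
    fix e assume e: "e \<in> {e \<in> H. v \<in> e}"
    then obtain j where j: "j < n" "e = {h j, h ((j + 1) mod n)}" using H_eq by blast
    with e i have "h i = h j \<or> h i = h ((j + 1) mod n)" by auto
    then have "i = j \<or> i = (j + 1) mod n" using h_inj i j mod_lt by metis
    then show "e \<in> {{h i, h ((i + 1) mod n)}, {h ((i + n - 1) mod n), h i}}"
    proof
      assume *: "i = (j + 1) mod n"
      have "(i + n - 1) mod n = j"
        using j * n3 by (cases "j + 1 = n") auto
      then show ?thesis using j * by auto
    qed (use j in auto)
  qed
  then have "degree H v \<le> card {{h i, h ((i + 1) mod n)}, {h ((i + n - 1) mod n), h i}}"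
    unfolding degree_def by (rule card_mono[rotated]) auto
  also have "\<dots> \<le> 2" by (simp add: card_insert_if)
  finally show ?thesis .
next
  case False
  then have "{e \<in> H. v \<in> e} = {}" by blast
  then show ?thesis unfolding degree_def by (metis card.empty zero_le)
qed

text \<open>The two neighbours of a vertex on such a cycle are distinct, so they cannot both be its
  predecessor in the tour: one of them is its successor. Hence the cycle is closed under the tour's
  successor map, and iterating that map reaches all n vertices.\<close>

lemma no_short_cycle:
  assumes "k < n" shows "\<not> has_cycle_len n H k"
proof
  assume "has_cycle_len n H k"
  then obtain c where k3: "3 \<le> k" and c: "inj_on c {..<k}" "c ` {..<k} \<subseteq> verts n"
    "\<And>i. i < k \<Longrightarrow> {c i, c ((i + 1) mod k)} \<in> H" unfolding has_cycle_len_def by blast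
  have "\<forall>i\<in>{..<k}. \<exists>j<n. c i = h j" using c(2) h_surj by blast
  then obtain f where f: "\<And>i. i < k \<Longrightarrow> f i < n \<and> c i = h (f i)" by (metis lessThan_iff)
  have step: "\<exists>j<k. f j = (f i + 1) mod n" if i: "i < k" for i
  proof -
    define a where "a = (i + k - 1) mod k"
    define b where "b = (i + 1) mod k"
    have ab: "a < k" "b < k" "a \<noteq> b" "(a + 1) mod k = i"
      using i k3 mod_pred_neq_Suc[of i k] mod_pred_Suc[of i k] by (auto simp: a_def b_def)
    have fab: "f a \<noteq> f b" using ab f c(1) by (metis inj_onD lessThan_iff)
    have "{h (f i), h (f b)} \<in> H" "{h (f a), h (f i)} \<in> H"
      using c(3)[OF i] c(3)[OF ab(1)] ab f i by (auto simp: b_def)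
    then have "f b = (f i + 1) mod n \<or> f i = (f b + 1) mod n"
      "f i = (f a + 1) mod n \<or> f a = (f i + 1) mod n"
      using neighbours f i ab by blast+
    moreover have "\<not> (f i = (f b + 1) mod n \<and> f i = (f a + 1) mod n)"
    proof
      assume "f i = (f b + 1) mod n \<and> f i = (f a + 1) mod n"
      then have "(f b + 1) mod n = (f a + 1) mod n" by simp
      moreover have "f a < n" "f b < n" using f ab by auto
      ultimately have "f a = f b"
        by (cases "f a + 1 = n"; cases "f b + 1 = n") auto
      with fab show False by simp
    qed
    ultimately show ?thesis using ab by blast
  qed
  have reach: "\<exists>i<k. f i = (f 0 + j) mod n" for j
  proof (induction j)
    case 0
    have "0 < k" using k3 by simp
    then show ?case using f[of 0] by auto
  next
    case (Suc j)
    then obtain i where i: "i < k" "f i = (f 0 + j) mod n" by blast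
    obtain i' where "i' < k" "f i' = (f i + 1) mod n" using step[OF i(1)] by blast
    with i show ?case by (auto simp: mod_Suc_eq intro!: exI[of _ i'])
  qed
  have "{..<n} \<subseteq> f ` {..<k}"
  proof
    fix m assume m: "m \<in> {..<n}"
    have "f 0 < n" using f[of 0] k3 by simp
    then have "(f 0 + (m + n - f 0)) mod n = m" using m by simp
    with reach[of "m + n - f 0"] show "m \<in> f ` {..<k}" by auto
  qed
  then have "n \<le> card (f ` {..<k})" by (metis card_lessThan card_mono finite_imageI finite_lessThan)
  also have "\<dots> \<le> k" using card_image_le[of "{..<k}" f] by simp
  finally show False using assms by simp
qed

end

lemma ham_cycle_ham: "ham_cycle n H \<Longrightarrow> 3 \<le> n \<Longrightarrow> \<exists>h. ham n h H"
  unfolding ham_cycle_def ham_def by blast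

text \<open>Paths are vertex lists, so either orientation may represent a path, and singleton lists
  stand for isolated vertices. The paths partition the vertex set, which makes \<open>card S\<close>
  the number of components of \<open>B\<close>.\<close>

definition path_system :: "nat \<Rightarrow> nat list set \<Rightarrow> nat set set \<Rightarrow> bool" where
  "path_system n S B \<longleftrightarrow> (\<forall>p\<in>S. p \<noteq> [] \<and> distinct p) \<and>
     (\<forall>p\<in>S. \<forall>q\<in>S. p \<noteq> q \<longrightarrow> set p \<inter> set q = {}) \<and>
     (\<Union>p\<in>S. set p) = verts n \<and> B = (\<Union>p\<in>S. path_edges p)"

text \<open>State of the generation with \<open>r\<close> edges still to be added: \<open>B\<close> then splits the vertices into
  exactly \<open>r\<close> paths (possibly trivial).\<close>
definition reach :: "nat \<Rightarrow> nat \<Rightarrow> nat set set \<Rightarrow> bool" where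
  "reach n r B \<longleftrightarrow> (if r = 0 then ham_cycle n B
     else (\<exists>S. path_system n S B \<and> card S = r) \<and> card B + r = n)"

section \<open>Path systems: joining two paths and closing the last one\<close>

locale path_sys =
  fixes n :: nat and S :: "nat list set" and B :: "nat set set"
  assumes ps: "path_system n S B"
begin

lemma nonempty: "p \<in> S \<Longrightarrow> p \<noteq> []"
  and dist: "p \<in> S \<Longrightarrow> distinct p"
  and B_eq: "B = (\<Union>p\<in>S. path_edges p)"
  using ps unfolding path_system_def by simp_all

lemma disj: "p \<in> S \<Longrightarrow> q \<in> S \<Longrightarrow> v \<in> set p \<Longrightarrow> v \<in> set q \<Longrightarrow> p = q"
  using ps unfolding path_system_def by (metis disjoint_iff)

lemma cover: "v \<in> verts n \<longleftrightarrow> (\<exists>p\<in>S. v \<in> set p)"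
  using ps unfolding path_system_def by (metis UN_iff)

text \<open>The heads serve as representatives of the paths, both for finiteness of \<open>S\<close>
  and for counting admissible edges from below.\<close>

lemma inj_hd: "inj_on hd S"
  by (rule inj_onI) (metis disj list.set_sel(1) nonempty)

lemma finite_S: "finite S"
proof -
  have "hd ` S \<subseteq> verts n" using nonempty cover by force
  then show ?thesis using inj_hd by (meson finite_imageD finite_subset finite_verts)
qed

lemma finite_B: "finite B" using finite_S B_eq by auto

lemma edge_in: "e \<in> B \<Longrightarrow> p \<in> S \<Longrightarrow> v \<in> e \<Longrightarrow> v \<in> set p \<Longrightarrow> e \<in> path_edges p"
proof -
  assume e: "e \<in> B" "p \<in> S" "v \<in> e" "v \<in> set p"
  then obtain q where q: "q \<in> S" "e \<in> path_edges q" using B_eq by auto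
  then have "v \<in> set q" using e(3) path_edges_subset by auto
  then show "e \<in> path_edges p" using disj[OF q(1) e(2) _ e(4)] q(2) by simp
qed

lemma degree_le: "degree B v \<le> 2"
proof (cases "\<exists>e\<in>B. v \<in> e")
  case True
  then obtain e p where "v \<in> e" and p: "p \<in> S" "e \<in> path_edges p" using B_eq by auto
  then have p: "p \<in> S" "v \<in> set p" using path_edges_subset by auto
  then obtain i where i: "i < length p" "v = p ! i" by (metis in_set_conv_nth)
  have "{e \<in> B. v \<in> e} \<subseteq> {{p ! i, p ! Suc i}, {p ! (i - 1), p ! i}}"
  proof
    fix e assume "e \<in> {e \<in> B. v \<in> e}"
    then have e: "e \<in> path_edges p" "v \<in> e" using edge_in p by auto
    then obtain j where j: "e = {p ! j, p ! Suc j}" "Suc j < length p" by (auto simp: path_edges_nth)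
    then have "i = j \<or> i = Suc j" using e i dist[OF p(1)] nth_eq_iff_index_eq
      by (metis Suc_lessD insertE singletonD)
    then show "e \<in> {{p ! i, p ! Suc i}, {p ! (i - 1), p ! i}}" using j by auto
  qed
  then have "degree B v \<le> card {{p ! i, p ! Suc i}, {p ! (i - 1), p ! i}}"
    unfolding degree_def by (rule card_mono[rotated]) auto
  also have "\<dots> \<le> 2" by (simp add: card_insert_if)
  finally show ?thesis .
next
  case False
  then have "{e \<in> B. v \<in> e} = {}" by blast
  then show ?thesis unfolding degree_def by (metis card.empty zero_le)
qed

lemma degree_interior:
  assumes "p \<in> S" "v \<in> set p" "v \<noteq> hd p" "v \<noteq> last p"
  shows "degree B v = 2"
proof -
  obtain i where i: "i < length p" "v = p ! i" using assms by (metis in_set_conv_nth)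
  have "i \<noteq> 0" using i assms by (metis hd_conv_nth nonempty)
  have "i \<noteq> length p - 1" using i assms by (metis last_conv_nth nonempty)
  with \<open>i \<noteq> 0\<close> i obtain j where j: "i = Suc j" "Suc i < length p" by (cases i) auto
  have "{{p ! j, p ! i}, {p ! i, p ! Suc i}} \<subseteq> {e \<in> B. v \<in> e}"
    using i j assms B_eq unfolding path_edges_nth by blast
  moreover have "{p ! j, p ! i} \<noteq> {p ! i, p ! Suc i}"
    using i j dist[OF assms(1)] by (auto simp: doubleton_eq_iff nth_eq_iff_index_eq)
  ultimately have "2 \<le> degree B v" unfolding degree_def
    using card_mono[of "{e \<in> B. v \<in> e}" "{{p ! j, p ! i}, {p ! i, p ! Suc i}}"] finite_B by auto
  then show ?thesis using degree_le[of v] by simp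
qed

text \<open>Consecutive edges share a vertex, so a cycle would stay inside one path. At its vertex
  of maximal position in that path both cycle neighbours have to sit one position lower, hence
  coincide.\<close>

lemma no_cycle: "\<not> has_cycle_len n B k"
proof
  assume "has_cycle_len n B k"
  then obtain c where k3: "3 \<le> k" and c: "inj_on c {..<k}" "c ` {..<k} \<subseteq> verts n"
    "\<And>i. i < k \<Longrightarrow> {c i, c ((i + 1) mod k)} \<in> B" unfolding has_cycle_len_def by blast
  obtain p where p: "p \<in> S" "c 0 \<in> set p" using c(2) cover k3 by fastforce
  have all: "c i \<in> set p" if "i < k" for i
    using that
  proof (induction i)
    case (Suc i)
    then have "{c i, c (Suc i)} \<in> path_edges p" using edge_in[OF _ p(1), of "{c i, c (Suc i)}" "c i"] c(3)[of i] by auto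
    then show ?case using path_edges_subset by blast
  qed (use p in simp)
  then have "\<forall>i<k. \<exists>j<length p. c i = p ! j" by (metis in_set_conv_nth)
  then obtain f where f: "\<And>i. i < k \<Longrightarrow> f i < length p \<and> c i = p ! f i" by metis
  have adj: "f ((i + 1) mod k) = Suc (f i) \<or> f i = Suc (f ((i + 1) mod k))" if i: "i < k" for i
  proof -
    let ?b = "(i + 1) mod k"
    have b: "?b < k" using k3 by simp
    have "{c i, c ?b} \<in> path_edges p" using edge_in[OF c(3)[OF i] p(1)] all[OF i] by auto
    then obtain j where "{c i, c ?b} = {p ! j, p ! Suc j}" "Suc j < length p"
      by (auto simp: path_edges_nth)
    then show ?thesis using f[OF i] f[OF b] dist[OF p(1)]
      by (auto simp: doubleton_eq_iff nth_eq_iff_index_eq)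
  qed
  have "finite (f ` {..<k})" "f ` {..<k} \<noteq> {}" using k3 by (auto simp: lessThan_empty_iff)
  then have "Max (f ` {..<k}) \<in> f ` {..<k}" "\<forall>j<k. f j \<le> Max (f ` {..<k})"
    by (rule Max_in) (use \<open>finite (f ` {..<k})\<close> in simp)
  then obtain i where i: "i < k" "\<forall>j<k. f j \<le> f i" by (elim imageE) auto
  define a where "a = (i + k - 1) mod k"
  define b where "b = (i + 1) mod k"
  have ab: "a < k" "b < k" "a \<noteq> b" "(a + 1) mod k = i"
    using i k3 mod_pred_neq_Suc[of i k] mod_pred_Suc[of i k] by (auto simp: a_def b_def)
  have "f i = Suc (f b)" using adj[OF i(1)] i(2) ab(2) by (auto simp: b_def)
  moreover have "f i = Suc (f a)" using adj[OF ab(1)] i(2) ab(1) ab(4) by auto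
  ultimately have "c a = c b" using f ab by simp
  then show False using c(1) ab by (auto simp: inj_on_def)
qed

lemma join:
  assumes P: "P \<in> S" "u = hd P \<or> u = last P" and Q: "Q \<in> S" "v = hd Q \<or> v = last Q"
    and "P \<noteq> Q"
  shows "\<exists>S'. path_system n S' (insert {u, v} B) \<and> card S = Suc (card S')"
    and "{u, v} \<notin> B" "{u, v} \<in> kn_edges n"
proof -
  \<comment> \<open>Reversal orients the paths so that \<open>u\<close> ends \<open>P'\<close> and
    \<open>v\<close> starts \<open>Q'\<close>; the joined path is then
    \<open>P' @ Q'\<close>.\<close>
  define P' where "P' = (if u = last P then P else rev P)"
  define Q' where "Q' = (if v = hd Q then Q else rev Q)"
  have ne: "P \<noteq> []" "Q \<noteq> []" using nonempty[OF P(1)] nonempty[OF Q(1)] by simp_all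
  have P': "last P' = u" "set P' = set P" "distinct P'" "path_edges P' = path_edges P" "P' \<noteq> []"
    using P(2) ne dist[OF P(1)] by (auto simp: P'_def last_rev)
  have Q': "hd Q' = v" "set Q' = set Q" "distinct Q'" "path_edges Q' = path_edges Q" "Q' \<noteq> []"
    using Q(2) ne dist[OF Q(1)] by (auto simp: Q'_def hd_rev)
  have uv: "u \<in> set P" "v \<in> set Q" using P(2) Q(2) ne by (metis hd_in_set last_in_set)+
  have PQ: "set P \<inter> set Q = {}" using disj P(1) Q(1) \<open>P \<noteq> Q\<close> by blast
  show "{u, v} \<notin> B"
    using edge_in[OF _ P(1), of "{u,v}" u] uv PQ path_edges_subset[of "{u,v}" P] by auto
  show "{u, v} \<in> kn_edges n"
  proof -
    have "u \<in> verts n" "v \<in> verts n" using uv cover P(1) Q(1) by metis+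
    moreover have "u \<noteq> v" using uv PQ by auto
    ultimately show ?thesis unfolding kn_edges_def by blast
  qed
  let ?S = "insert (P' @ Q') (S - {P, Q})"
  have nin: "P' @ Q' \<notin> S - {P, Q}"
    using disj[OF _ P(1), of "P' @ Q'" u] uv(1) P'(2) by auto
  have card: "card S = Suc (card ?S)"
  proof -
    have "card ?S = Suc (card (S - {P, Q}))" using nin finite_S by simp
    moreover have "card (S - {P, Q}) = card S - 2"
      using P(1) Q(1) \<open>P \<noteq> Q\<close> by (subst card_Diff_subset) auto
    moreover have "2 \<le> card S" using card_mono[of S "{P, Q}"] finite_S P(1) Q(1) \<open>P \<noteq> Q\<close> by auto
    ultimately show ?thesis by simp
  qed
  have "path_system n ?S (insert {u, v} B)"
    unfolding path_system_def
  proof (intro conjI ballI impI)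
    fix p assume "p \<in> ?S"
    then show "p \<noteq> []" "distinct p" using nonempty dist P'(2,3,5) Q'(2,3) PQ by auto
  next
    fix p q assume "p \<in> ?S" "q \<in> ?S" "p \<noteq> q"
    moreover have "set r \<inter> set (P' @ Q') = {}" if "r \<in> S - {P, Q}" for r
      using that P'(2) Q'(2) disj[OF _ P(1)] disj[OF _ Q(1)] by auto
    ultimately show "set p \<inter> set q = {}" using disj by blast
  next
    have "(\<Union>p\<in>?S. set p) = (\<Union>p\<in>S. set p)" using P'(2) Q'(2) P(1) Q(1) by auto
    then show "(\<Union>p\<in>?S. set p) = verts n" using cover by auto
  next
    have "(\<Union>p\<in>?S. path_edges p) = insert {u, v} (\<Union>p\<in>S. path_edges p)"
      using path_edges_append[OF P'(5) Q'(5)] P'(1,4) Q'(1,4) P(1) Q(1) by auto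
    then show "insert {u, v} B = (\<Union>p\<in>?S. path_edges p)" using B_eq by simp
  qed
  with card show "\<exists>S'. path_system n S' (insert {u, v} B) \<and> card S = Suc (card S')" by blast
qed

text \<open>After the join the edges again form a path system, and every path system has degrees at
  most 2 and no cycle at all.\<close>

lemma join_admissible:
  assumes P: "P \<in> S" "u = hd P \<or> u = last P" and Q: "Q \<in> S" "v = hd Q \<or> v = last Q"
    and "P \<noteq> Q"
  shows "{u, v} \<in> admissible n B"
proof -
  obtain S' where "path_system n S' (insert {u, v} B)" using join(1)[OF assms] by blast
  then interpret J: path_sys n S' "insert {u, v} B" by unfold_locales
  show ?thesis unfolding admissible_def
    using join(2,3)[OF assms] J.no_cycle J.degree_le by (auto simp: less_Suc_eq_le eval_nat_numeral)
qed

lemma endpoint: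
  assumes "e \<in> admissible n B" "v \<in> e" "p \<in> S" "v \<in> set p"
  shows "v = hd p \<or> v = last p"
proof (rule ccontr)
  assume "\<not> ?thesis"
  then have "degree B v = 2" using degree_interior assms by blast
  then have "degree (insert e B) v = 3"
    using degree_insert[OF finite_B] assms by (auto simp: admissible_def)
  moreover have "v \<in> verts n" using cover assms by blast
  ultimately show False using assms(1) by (auto simp: admissible_def)
qed

text \<open>The edge between the two ends closes the path. Requiring it to be absent from
  \<open>B\<close> excludes two-vertex paths, whose ends are already joined, and so provides the
  length 3 in \<open>has_cycle_len\<close>. The set \<open>C\<close> is left free because the lemma
  serves both for \<open>insert e B\<close> and for a tour containing the path.\<close>

lemma closed_path_length:
  assumes "p \<in> S" "hd p \<noteq> last p" "{hd p, last p} \<notin> B" "insert {hd p, last p} (path_edges p) \<subseteq> C"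
  shows "has_cycle_len n C (length p)"
proof -
  have l: "3 \<le> length p"
  proof (rule ccontr)
    assume "\<not> 3 \<le> length p"
    with assms(2) nonempty[OF assms(1)] obtain x y where "p = [x, y]"
      by (cases p rule: path_edges.cases; force simp: Suc_le_eq)
    then show False using assms B_eq by force
  qed
  have "inj_on ((!) p) {..<length p}" using dist[OF assms(1)] by (simp add: inj_on_nth)
  moreover have "(!) p ` {..<length p} \<subseteq> verts n" using cover assms(1) nth_mem by blast
  moreover have "{p ! i, p ! ((i + 1) mod length p)} \<in> C" if "i < length p" for i
  proof (cases "Suc i = length p")
    case True
    then have "{p ! i, p ! ((i + 1) mod length p)} = {hd p, last p}"
      using nonempty[OF assms(1)] by (auto simp: hd_conv_nth last_conv_nth True[symmetric])
    then show ?thesis using assms by simp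
  next
    case False
    then have "{p ! i, p ! ((i + 1) mod length p)} \<in> path_edges p"
      using that unfolding path_edges_nth by auto
    then show ?thesis using assms by blast
  qed
  ultimately show ?thesis using l unfolding has_cycle_len_def by auto
qed

lemma spanning:
  assumes p: "p \<in> S" "n \<le> length p"
  shows "S = {p}" and "length p = n" and "set p = verts n"
proof -
  have c: "card (set p) = length p" using dist p by (simp add: distinct_card)
  have s: "set p \<subseteq> verts n" using cover p by blast
  then have "length p \<le> n" using c card_mono[of "verts n" "set p"] by simp
  then show l: "length p = n" using p by simp
  show v: "set p = verts n" using s c l by (simp add: card_subset_eq)
  show "S = {p}"
  proof
    show "S \<subseteq> {p}"
    proof
      fix q assume q: "q \<in> S"
      then have "hd q \<in> set p" using v cover nonempty by (metis list.set_sel(1))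
      then show "q \<in> {p}" using disj q p nonempty by (metis list.set_sel(1) singletonI)
    qed
  qed (use p in simp)
qed

lemma closing:
  assumes "S = {p}" "3 \<le> n"
  shows "ham_cycle n (insert {hd p, last p} B)" "{hd p, last p} \<in> admissible n B" "hd p \<noteq> last p"
proof -
  have p: "p \<in> S" using assms by simp
  have sp: "set p = verts n" using cover assms by blast
  have l: "length p = n" using dist[OF p] sp by (metis card_verts distinct_card)
  have bij: "bij_betw ((!) p) {..<n} (verts n)"
    using dist[OF p] sp l by (simp add: bij_betw_nth)
  have hd: "hd p = p ! 0" "last p = p ! (n - 1)"
    using nonempty[OF p] l by (auto simp: hd_conv_nth last_conv_nth)
  have Beq: "B = {{p ! i, p ! Suc i} | i. Suc i < n}" using B_eq assms l by (simp add: path_edges_nth)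
  have ends: "hd p \<noteq> last p" using hd dist[OF p] l assms by (simp add: nth_eq_iff_index_eq)
  have "{{p ! i, p ! ((i + 1) mod n)} | i. i < n} = insert {hd p, last p} B" (is "?H = ?I")
  proof
    show "?H \<subseteq> ?I"
    proof
      fix e assume "e \<in> ?H"
      then obtain i where i: "i < n" "e = {p ! i, p ! ((i + 1) mod n)}" by blast
      show "e \<in> ?I"
      proof (cases "Suc i = n")
        case True
        then have "i = n - 1" "(i + 1) mod n = 0" by auto
        then show ?thesis using i hd by auto
      next
        case False
        then have "e = {p ! i, p ! Suc i}" "Suc i < n" using i by auto
        then show ?thesis using Beq by blast
      qed
    qed
    show "?I \<subseteq> ?H"
    proof
      fix e assume "e \<in> ?I"
      then consider "e = {hd p, last p}" | i where "e = {p ! i, p ! Suc i}" "Suc i < n"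
        using Beq by blast
      then show "e \<in> ?H"
      proof cases
        case 1
        have "(n - 1 + 1) mod n = 0" "n - 1 < n" using assms by auto
        then show ?thesis using 1 hd by (smt (verit) insert_commute mem_Collect_eq)
      next
        case (2 i)
        then have "e = {p ! i, p ! ((i + 1) mod n)}" "i < n" by auto
        then show ?thesis by blast
      qed
    qed
  qed
  then interpret hm: ham n "(!) p" "insert {hd p, last p} B"
    using assms bij by unfold_locales auto
  show "ham_cycle n (insert {hd p, last p} B)" by (rule hm.ham_cycle)
  show "hd p \<noteq> last p" by fact
  have "{hd p, last p} \<notin> B"
  proof
    assume "{hd p, last p} \<in> B"
    then obtain i where "{p ! 0, p ! (n - 1)} = {p ! i, p ! Suc i}" "Suc i < n"
      using Beq hd by auto
    then show False using dist[OF p] l assms by (auto simp: doubleton_eq_iff nth_eq_iff_index_eq)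
  qed
  then show "{hd p, last p} \<in> admissible n B"
    unfolding admissible_def using hm.H_subset hm.degree_H_le hm.no_short_cycle
    by (auto simp: less_Suc_eq_le eval_nat_numeral)
qed

text \<open>Both endpoints of an admissible edge are path ends. If they belong to different paths,
  these merge; if to the same path, the edge closes it, and the ban on cycles shorter than n forces
  that path to be Hamiltonian.\<close>

lemma step:
  assumes e: "e \<in> admissible n B" and n3: "3 \<le> n"
  shows "(card S = 1 \<and> ham_cycle n (insert e B)) \<or>
    (\<exists>S'. path_system n S' (insert e B) \<and> card S = Suc (card S'))"
proof -
  obtain u v where uv: "e = {u, v}" "u \<in> verts n" "v \<in> verts n" "u \<noteq> v"
    using e unfolding admissible_def kn_edges_def by blast
  obtain P Q where P: "P \<in> S" "u \<in> set P" and Q: "Q \<in> S" "v \<in> set Q" using cover uv by blast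
  have u: "u = hd P \<or> u = last P" and v: "v = hd Q \<or> v = last Q"
    using endpoint[OF e] P Q uv by auto
  show ?thesis
  proof (cases "P = Q")
    case False
    then show ?thesis using join(1)[OF P(1) u Q(1) v] uv by simp
  next
    case True
    then have e': "e = {hd P, last P}" "hd P \<noteq> last P" using u v uv by auto
    have "{hd P, last P} \<notin> B" using e e' by (auto simp: admissible_def)
    then have "has_cycle_len n (insert e B) (length P)"
    proof (intro closed_path_length[OF P(1) e'(2)])
      show "insert {hd P, last P} (path_edges P) \<subseteq> insert e B" using e'(1) B_eq P(1) by auto
    qed
    then have "n \<le> length P" using e unfolding admissible_def by (metis (lifting) mem_Collect_eq not_le)
    then have "S = {P}" by (rule spanning(1)[OF P(1)])
    then show ?thesis using closing(1)[OF _ n3] e'(1) by simp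
  qed
qed

end

lemma reach_empty: "3 \<le> n \<Longrightarrow> reach n n {}"
proof -
  assume "3 \<le> n"
  have "path_system n ((\<lambda>v. [v]) ` verts n) {}" by (auto simp: path_system_def)
  moreover have "card ((\<lambda>v. [v]) ` verts n) = n" by (subst card_image) (auto simp: inj_on_def)
  ultimately show ?thesis using \<open>3 \<le> n\<close> unfolding reach_def by auto
qed

lemma reach_pos:
  assumes "reach n r B" "0 < r"
  obtains S where "path_sys n S B" "card S = r" "card B + r = n" "finite B"
proof -
  obtain S where S: "path_system n S B" "card S = r" "card B + r = n"
    using assms unfolding reach_def by (auto split: if_splits)
  then interpret path_sys n S B by unfold_locales
  show thesis using that[OF path_sys_axioms S(2,3) finite_B] .
qed

lemma ham_cycle_facts:
  assumes "ham_cycle n X" "3 \<le> n"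
  shows "card X = n" "finite X" "X \<subseteq> kn_edges n"
proof -
  obtain h where "ham n h X" using ham_cycle_ham assms by blast
  then interpret ham n h X .
  show "card X = n" "finite X" "X \<subseteq> kn_edges n" using card_H finite_H H_subset by auto
qed

lemma reach_card: "reach n r B \<Longrightarrow> 3 \<le> n \<Longrightarrow> card B + r = n"
  using ham_cycle_facts by (cases "r = 0") (auto simp: reach_def)

lemma reach_finite:
  assumes "reach n r B" "3 \<le> n" shows "finite B"
proof (cases "r = 0")
  case True
  then show ?thesis using ham_cycle_facts(2) assms by (simp add: reach_def)
next
  case False
  then show ?thesis using reach_pos[OF assms(1)] by auto
qed

lemma reach_Suc_not_ham: "reach n (Suc r) B \<Longrightarrow> 3 \<le> n \<Longrightarrow> \<not> ham_cycle n B"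
  using reach_card[of n "Suc r" B] ham_cycle_facts(1)[of n B] by auto

lemma reach_insert:
  assumes "reach n (Suc r) B" "e \<in> admissible n B" "3 \<le> n"
  shows "reach n r (insert e B)"
proof -
  obtain S where S: "path_sys n S B" "card S = Suc r" "card B + Suc r = n" "finite B"
    using reach_pos[OF assms(1)] by auto
  interpret path_sys n S B by (rule S)
  have c: "card (insert e B) = Suc (card B)" using assms(2) S(4) by (auto simp: admissible_def)
  from step[OF assms(2,3)] show ?thesis
  proof (elim disjE conjE exE)
    assume "card S = 1" "ham_cycle n (insert e B)"
    then show ?thesis using S by (simp add: reach_def)
  next
    fix S' assume S': "path_system n S' (insert e B)" "card S = Suc (card S')"
    interpret S': path_sys n S' "insert e B" using S' by unfold_locales
    \<comment> \<open>The vertex set is nonempty, so at least one path is left; hence r > 0 here and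
      the second branch of \<open>reach\<close> applies.\<close>
    have "S' \<noteq> {}" using S'.cover[of 1] assms(3) by (auto simp: verts_def)
    then have "card S' \<noteq> 0" using S'.finite_S by simp
    then show ?thesis using S S' c by (auto simp: reach_def)
  qed
qed

section \<open>Counting admissible edges\<close>

context path_sys begin

lemma head_pairs_admissible: "{e. e \<subseteq> hd ` S \<and> card e = 2} \<subseteq> admissible n B"
proof
  fix e assume "e \<in> {e. e \<subseteq> hd ` S \<and> card e = 2}"
  then obtain u v where e: "e = {u, v}" "u \<noteq> v" "u \<in> hd ` S" "v \<in> hd ` S"
    by (auto simp: card_2_iff)
  then obtain P Q where "P \<in> S" "u = hd P" "Q \<in> S" "v = hd Q" by auto
  then show "e \<in> admissible n B" using join_admissible[of P u Q v] e by auto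
qed

lemma admissible_subset_end_pairs:
  "admissible n B \<subseteq> {e. e \<subseteq> hd ` S \<union> last ` S \<and> card e = 2}"
proof
  fix e assume e: "e \<in> admissible n B"
  then obtain u v where uv: "e = {u, v}" "u \<in> verts n" "v \<in> verts n" "u \<noteq> v"
    unfolding admissible_def kn_edges_def by blast
  have "w \<in> hd ` S \<union> last ` S" if "w \<in> e" for w
  proof -
    have "w \<in> verts n" using that uv by auto
    then obtain p where "p \<in> S" "w \<in> set p" using cover by auto
    then show ?thesis using endpoint[OF e that] by auto
  qed
  then show "e \<in> {e. e \<subseteq> hd ` S \<union> last ` S \<and> card e = 2}" using uv by auto
qed

text \<open>Admissible edges join path ends, and r paths have at most 2r of them.\<close>

lemma card_admissible_le: "card (admissible n B) \<le> 2 * (card S)\<^sup>2"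
proof -
  let ?E = "hd ` S \<union> last ` S"
  have fin: "finite ?E" using finite_S by simp
  have "card ?E \<le> card (hd ` S) + card (last ` S)" by (rule card_Un_le)
  also have "\<dots> \<le> 2 * card S" using card_image_le[OF finite_S] by (metis add_mono mult_2)
  finally have E: "card ?E \<le> 2 * card S" .
  have "card (admissible n B) \<le> card {e. e \<subseteq> ?E \<and> card e = 2}"
    using admissible_subset_end_pairs fin by (intro card_mono) auto
  also have "\<dots> = card ?E * (card ?E - 1) div 2" using n_subsets[OF fin] choose_two by simp
  also have "\<dots> \<le> (2 * card S) * (2 * card S) div 2"
    using E by (intro div_le_mono mult_le_mono) auto
  also have "\<dots> = 2 * (card S)\<^sup>2" by (simp add: power2_eq_square)
  finally show ?thesis .
qed

text \<open>Each pair of paths contributes at least the edge between their heads.\<close>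

lemma card_admissible_ge: "card S * (card S - 1) div 2 \<le> card (admissible n B)"
proof -
  have "card {e. e \<subseteq> hd ` S \<and> card e = 2} = card S * (card S - 1) div 2"
    using n_subsets[of "hd ` S" 2] finite_S card_image[OF inj_hd] choose_two by simp
  then show ?thesis using card_mono[OF finite_admissible head_pairs_admissible] by simp
qed

text \<open>The generation never gets stuck: two paths can be joined, and a single remaining path
  can be closed. This makes every draw a genuine distribution.\<close>

lemma admissible_nonempty:
  assumes "3 \<le> n" shows "admissible n B \<noteq> {}"
proof (cases "card S \<le> 1")
  case False
  then obtain P Q where "P \<in> S" "Q \<in> S" "P \<noteq> Q" by (metis card_le_Suc0_iff_eq finite_S One_nat_def)
  then show ?thesis using join_admissible[of P "hd P" Q "hd Q"] by blast
next
  case True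
  have "S \<noteq> {}" using cover[of 1] assms by (auto simp: verts_def)
  with True have "card S = 1" using finite_S by (simp add: le_Suc_eq)
  then obtain p where "S = {p}" by (auto simp: card_1_singleton_iff)
  then show ?thesis using closing(2)[OF _ assms] by blast
qed

text \<open>An inadmissible remaining edge of \<^term>\<open>H\<close> either touches a vertex incident to a
  foreign edge, or joins the two ends of a path containing one.\<close>
lemma card_admissible_ham:
  assumes "ham n h H" and r: "card B + card S = n"
  shows "card S \<le> card (admissible n B \<inter> H) + 4 * card (B - H)"
proof -
  interpret ham n h H by fact
  define U where "U = \<Union>(B - H)"
  define A1 where "A1 = {e \<in> H. \<exists>u\<in>U. u \<in> e}"
  define S2 where "S2 = {p \<in> S. \<not> path_edges p \<subseteq> H}"
  define A2 where "A2 = (\<lambda>p. {hd p, last p}) ` S2"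
  have card_edge: "finite e \<and> card e \<le> 2" if "e \<in> B" for e
    using that B_eq by (auto simp: path_edges_nth card_insert_if)
  have "card U \<le> (\<Sum>e\<in>B - H. card e)" unfolding U_def
    using finite_B by (rule_tac card_Union_le_sum_card)
  also have "\<dots> \<le> (\<Sum>e\<in>B - H. 2)" using card_edge by (intro sum_mono) auto
  finally have U: "card U \<le> 2 * card (B - H)" by simp
  have finU: "finite U" unfolding U_def using finite_B card_edge by (auto intro!: finite_Union)
  have "A1 = (\<Union>u\<in>U. {e \<in> H. u \<in> e})" unfolding A1_def by auto
  then have "card A1 \<le> (\<Sum>u\<in>U. card {e \<in> H. u \<in> e})" using card_UN_le[OF finU] by simp
  also have "\<dots> \<le> (\<Sum>u\<in>U. 2)" using degree_H_le unfolding degree_def by (intro sum_mono) auto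
  finally have A1: "card A1 \<le> 4 * card (B - H)" using U by simp
  have fin2: "finite S2" using finite_S unfolding S2_def by simp
  have A2: "card A2 \<le> card (B - H)"
  proof -
    \<comment> \<open>Choosing a foreign edge in each path of \<open>S2\<close> is injective because
      distinct paths share no vertex.\<close>
    have "\<forall>p\<in>S2. \<exists>f. f \<in> path_edges p - H" unfolding S2_def by auto
    then obtain g where g: "\<And>p. p \<in> S2 \<Longrightarrow> g p \<in> path_edges p - H" by metis
    have "inj_on g S2"
    proof (rule inj_onI)
      fix p q assume pq: "p \<in> S2" "q \<in> S2" "g p = g q"
      have "g p \<noteq> {}" using g[OF pq(1)] path_edges_nonempty by auto
      then obtain v where v: "v \<in> g p" by auto
      have "v \<in> set p" "v \<in> set q" using v g[OF pq(1)] g[OF pq(2)] pq(3) path_edges_subset by fastforce+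
      then show "p = q" using disj pq unfolding S2_def by auto
    qed
    moreover have "g ` S2 \<subseteq> B - H" using g B_eq unfolding S2_def by auto
    ultimately have "card S2 \<le> card (B - H)" using finite_B by (intro card_inj_on_le) auto
    moreover have "card A2 \<le> card S2" unfolding A2_def using fin2 by (rule card_image_le)
    ultimately show ?thesis by simp
  qed
  have sub: "H - B \<subseteq> (admissible n B \<inter> H) \<union> (A1 \<union> A2)"
  proof
    fix e assume e: "e \<in> H - B"
    then obtain u v where uv: "e = {u, v}" "u \<in> verts n" "v \<in> verts n" "u \<noteq> v"
      using H_subset unfolding kn_edges_def by blast
    obtain P where P: "P \<in> S" "u \<in> set P" using cover uv(2) by auto
    obtain Q where Q: "Q \<in> S" "v \<in> set Q" using cover uv(3) by auto
    \<comment> \<open>An interior vertex already has degree 2 in \<open>B\<close>. If both of those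
      edges belonged to \<open>H\<close>, then \<open>e\<close> would be a third edge of
      \<open>H\<close> at that vertex.\<close>
    have inner: "e \<in> A1" if w: "w \<in> e" "p \<in> S" "w \<in> set p" "\<not> (w = hd p \<or> w = last p)" for w p
    proof (rule ccontr)
      assume "e \<notin> A1"
      then have "w \<notin> U" using e w unfolding A1_def by auto
      then have "{f \<in> B. w \<in> f} \<subseteq> H" unfolding U_def by auto
      then have "insert e {f \<in> B. w \<in> f} \<subseteq> {f \<in> H. w \<in> f}" using e w by auto
      then have "card (insert e {f \<in> B. w \<in> f}) \<le> card {f \<in> H. w \<in> f}"
        using finite_H by (intro card_mono) auto
      also have "\<dots> \<le> 2" using degree_H_le[of w] unfolding degree_def .
      finally have "card (insert e {f \<in> B. w \<in> f}) \<le> 2" .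
      moreover have "card {f \<in> B. w \<in> f} = 2" using degree_interior[of p w] w unfolding degree_def by auto
      ultimately show False using e finite_B by simp
    qed
    show "e \<in> (admissible n B \<inter> H) \<union> (A1 \<union> A2)"
    proof (cases "(u = hd P \<or> u = last P) \<and> (v = hd Q \<or> v = last Q)")
      case False
      then show ?thesis using inner[of u P] inner[of v Q] P Q uv(1) by auto
    next
      case ends: True
      show ?thesis
      proof (cases "P = Q")
        case False
        then show ?thesis using join_admissible[of P u Q v] P Q ends uv(1) e by auto
      next
        case True
        then have e': "e = {hd P, last P}" "hd P \<noteq> last P" using ends uv by auto
        show ?thesis
        proof (cases "path_edges P \<subseteq> H")
          case False
          then show ?thesis using P e' unfolding A2_def S2_def by auto
        next
          case PH: True
          \<comment> \<open>A path inside \<open>H\<close> closed by an edge of \<open>H\<close> is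
            a cycle of \<open>H\<close>, hence all of \<open>H\<close>; then \<open>e\<close> is the
            legitimate final edge.\<close>
          have "has_cycle_len n H (length P)"
            using closed_path_length[OF P(1) e'(2), of H] e e' PH by auto
          then have "n \<le> length P" using no_short_cycle not_le by auto
          then have "S = {P}" by (rule spanning(1)[OF P(1)])
          then show ?thesis using closing(2)[OF _ n3] e' e by auto
        qed
      qed
    qed
  qed
  have finA1: "finite A1" unfolding A1_def using finite_H by simp
  have finA2: "finite A2" unfolding A2_def using fin2 by simp
  have "card (H - B) \<le> card ((admissible n B \<inter> H) \<union> (A1 \<union> A2))"
    using sub finA1 finA2 by (intro card_mono) auto
  also have "\<dots> \<le> card (admissible n B \<inter> H) + card (A1 \<union> A2)" by (rule card_Un_le)
  also have "\<dots> \<le> card (admissible n B \<inter> H) + (card A1 + card A2)"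
    using card_Un_le[of A1 A2] by simp
  finally have "card (H - B) \<le> card (admissible n B \<inter> H) + 5 * card (B - H)" using A1 A2 by simp
  \<comment> \<open>Writing d for \<open>card (B - H)\<close> and r for \<open>card S\<close>, the
    tour lacks exactly r + d edges in \<open>B\<close>. So r + d is at most the admissible count
    plus 5d, which turns 5 into 4.\<close>
  moreover have "card (H - B) + card (B \<inter> H) = n"
    using card_Diff_subset_Int[of H B] card_H finite_H card_mono[of H "B \<inter> H"]
    by (simp add: Int_commute)
  moreover have "card (B - H) + card (B \<inter> H) = card B"
    using card_Diff_subset_Int[of B H] finite_B card_mono[of B "B \<inter> H"] by simp
  ultimately show ?thesis using r by simp
qed

end

section \<open>Edge-based generation\<close>

lemma pmf_weighted_pmf:
  assumes "finite A" "A \<noteq> {}" "\<And>x. x \<in> A \<Longrightarrow> 0 < w x"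
  shows "pmf (weighted_pmf A w) x = (if x \<in> A then w x / sum w A else 0)"
proof -
  let ?f = "\<lambda>x. if x \<in> A then w x / sum w A else 0"
  have pos: "0 < sum w A" using assms by (intro sum_pos) auto
  have nn: "0 \<le> ?f x" for x using pos assms(3) by (auto intro!: divide_nonneg_pos less_imp_le)
  have "(\<integral>\<^sup>+ x. ennreal (?f x) \<partial>count_space UNIV) = (\<Sum>x\<in>A. ennreal (?f x))"
    using assms by (intro nn_integral_count_space') auto
  also have "\<dots> = ennreal (\<Sum>x\<in>A. ?f x)" using nn by (rule sum_ennreal)
  also have "(\<Sum>x\<in>A. ?f x) = 1" using pos by (simp add: sum_divide_distrib[symmetric])
  finally show ?thesis unfolding weighted_pmf_def using nn by (subst pmf_embed_pmf) auto
qed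

lemma set_weighted_pmf:
  assumes "finite A" "A \<noteq> {}" "\<And>x. x \<in> A \<Longrightarrow> 0 < w x"
  shows "set_pmf (weighted_pmf A w) \<subseteq> A"
  using pmf_weighted_pmf[OF assms] by (auto simp: set_pmf_iff split: if_splits)

lemma prob_weighted_pmf:
  assumes "finite A" "A \<noteq> {}" "\<And>x. x \<in> A \<Longrightarrow> 0 < w x"
  shows "measure_pmf.prob (weighted_pmf A w) G = sum w (A \<inter> G) / sum w A"
proof -
  let ?p = "weighted_pmf A w"
  have "measure_pmf.prob ?p G = measure_pmf.prob ?p (A \<inter> G)"
    using set_weighted_pmf[of A w] assms
    by (intro measure_pmf.finite_measure_eq_AE) (auto simp: AE_measure_pmf_iff)
  also have "\<dots> = (\<Sum>x\<in>A \<inter> G. pmf ?p x)" using assms by (simp add: measure_measure_pmf_finite)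
  also have "\<dots> = (\<Sum>x\<in>A \<inter> G. w x / sum w A)" using pmf_weighted_pmf[OF assms] by (intro sum.cong) auto
  finally show ?thesis by (simp add: sum_divide_distrib)
qed

lemma prob_bind_pmf:
  "measure_pmf.prob (bind_pmf p f) E = measure_pmf.expectation p (\<lambda>x. measure_pmf.prob (f x) E)"
proof -
  have "emeasure (measure_pmf (bind_pmf p f)) E = (\<integral>\<^sup>+ x. emeasure (measure_pmf (f x)) E \<partial>measure_pmf p)"
    by (simp add: emeasure_bind_pmf)
  also have "\<dots> = (\<integral>\<^sup>+ x. ennreal (measure_pmf.prob (f x) E) \<partial>measure_pmf p)"
    by (simp add: measure_pmf.emeasure_eq_measure)
  also have "\<dots> = ennreal (measure_pmf.expectation p (\<lambda>x. measure_pmf.prob (f x) E))"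
    by (rule nn_integral_eq_integral) (auto intro!: measure_pmf.integrable_const_bound[where B = 1])
  finally show ?thesis by (simp add: measure_pmf.emeasure_eq_measure integral_nonneg_AE)
qed

text \<open>With g = \<open>measure_pmf.prob p G\<close>, conditioning on the first draw gives at
  most a (1 - g) + b g, which increases in g because a <= b. This drives the inductions over the
  generation steps.\<close>

lemma prob_bind_pmf_le:
  assumes "\<And>x. x \<in> set_pmf p \<Longrightarrow> x \<notin> G \<Longrightarrow> measure_pmf.prob (f x) E \<le> a"
    and "\<And>x. x \<in> set_pmf p \<Longrightarrow> x \<in> G \<Longrightarrow> measure_pmf.prob (f x) E \<le> b"
    and "a \<le> b" "measure_pmf.prob p G \<le> q"
  shows "measure_pmf.prob (bind_pmf p f) E \<le> a + (b - a) * q"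
proof -
  have "measure_pmf.prob (bind_pmf p f) E \<le> measure_pmf.expectation p (\<lambda>x. a + (b - a) * indicator G x)"
    unfolding prob_bind_pmf
  proof (rule integral_mono_AE)
    show "integrable (measure_pmf p) (\<lambda>x. measure_pmf.prob (f x) E)"
      by (auto intro!: measure_pmf.integrable_const_bound[where B = 1])
    show "integrable (measure_pmf p) (\<lambda>x. a + (b - a) * indicator G x)"
      by (intro measure_pmf.integrable_const_bound[where B = "\<bar>a\<bar> + \<bar>b - a\<bar>"])
        (auto simp: indicator_def abs_mult intro!: AE_I2)
    show "AE x in measure_pmf p. measure_pmf.prob (f x) E \<le> a + (b - a) * indicator G x"
      using assms(1,2) by (auto simp: AE_measure_pmf_iff indicator_def)
  qed
  also have "\<dots> = a + (b - a) * measure_pmf.prob p G"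
    by (subst Bochner_Integration.integral_add)
      (auto intro!: measure_pmf.integrable_const_bound[where B = 1] integrable_mult_right)
  also have "\<dots> \<le> a + (b - a) * q" using assms(3,4) by (intro add_left_mono mult_left_mono) auto
  finally show ?thesis .
qed

text \<open>Positivity on all edges keeps the total weight of a nonempty admissible set nonzero, as
  the formulas for \<open>weighted_pmf\<close> require. Both the uniform start matrix and the
  matrices of tours are instances.\<close>

locale gen =
  fixes n :: nat and P :: "nat \<Rightarrow> nat \<Rightarrow> real"
  assumes n3: "3 \<le> n" and weight_pos: "e \<in> kn_edges n \<Longrightarrow> 0 < edge_weight P e"
begin

abbreviation W :: "nat set set \<Rightarrow> nat set pmf" where
  "W B \<equiv> weighted_pmf (admissible n B) (edge_weight P)"

lemma admissible_weight_pos: "e \<in> admissible n B \<Longrightarrow> 0 < edge_weight P e"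
  using weight_pos by (auto simp: admissible_def)

lemma reach_admissible: "reach n r B \<Longrightarrow> 0 < r \<Longrightarrow> admissible n B \<noteq> {}"
  using reach_pos[of n r B] path_sys.admissible_nonempty n3 by metis

lemma set_W: "reach n r B \<Longrightarrow> 0 < r \<Longrightarrow> set_pmf (W B) \<subseteq> admissible n B"
  using set_weighted_pmf[OF finite_admissible reach_admissible admissible_weight_pos] .

lemma prob_W: "reach n r B \<Longrightarrow> 0 < r \<Longrightarrow> measure_pmf.prob (W B) G
    = sum (edge_weight P) (admissible n B \<inter> G) / sum (edge_weight P) (admissible n B)"
  using prob_weighted_pmf[OF finite_admissible reach_admissible admissible_weight_pos] .

lemma gen_steps_Suc: "reach n (Suc r) B \<Longrightarrow>
    gen_steps n P (Suc r) B = bind_pmf (W B) (\<lambda>e. gen_steps n P r (insert e B))"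
  using reach_Suc_not_ham n3 by simp

lemma set_gen_steps:
  "reach n r B \<Longrightarrow> X \<in> set_pmf (gen_steps n P r B) \<Longrightarrow> B \<subseteq> X \<and> ham_cycle n X"
proof (induction r arbitrary: B)
  case 0
  then show ?case by (simp add: reach_def)
next
  case (Suc r)
  then obtain e where e: "e \<in> set_pmf (W B)" "X \<in> set_pmf (gen_steps n P r (insert e B))"
    unfolding gen_steps_Suc[OF Suc.prems(1)] by auto
  then have "e \<in> admissible n B" using set_W[OF Suc.prems(1)] by auto
  from Suc.IH[OF reach_insert[OF Suc.prems(1) this n3] e(2)] show ?case by simp
qed

lemma set_generate: "X \<in> set_pmf (generate n P) \<Longrightarrow> ham_cycle n X"
  unfolding generate_def using set_gen_steps[OF reach_empty[OF n3]] by blast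

text \<open>\<open>2 ^ card (B \<inter> G)\<close> grows in expectation by a factor of at most \<open>1 + q r\<close> per step until the
  stopping condition holds, at which point it must have reached \<open>2 ^ L\<close> for \<open>E\<close> to occur.\<close>
lemma gen_steps_tail:
  assumes q: "\<And>r B. reach n r B \<Longrightarrow> 0 < r \<Longrightarrow> \<not> stop r (card (B \<inter> G)) \<Longrightarrow>
      measure_pmf.prob (W B) G \<le> q r"
    and q0: "\<And>r. 0 \<le> q r"
    and stop: "\<And>r B X. reach n r B \<Longrightarrow> r = 0 \<or> stop r (card (B \<inter> G)) \<Longrightarrow> B \<subseteq> X \<Longrightarrow>
      ham_cycle n X \<Longrightarrow> X \<in> E \<Longrightarrow> L \<le> card (B \<inter> G)"
  shows "reach n r B \<Longrightarrow> measure_pmf.prob (gen_steps n P r B) E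
      \<le> 2 ^ card (B \<inter> G) / 2 ^ L * (\<Prod>i\<in>{1..r}. 1 + q i)"
proof (induction r arbitrary: B)
  case (0 B)
  show ?case
  proof (cases "B \<in> E")
    case True
    then have "L \<le> card (B \<inter> G)" using stop[OF 0, of B] 0 by (simp add: reach_def)
    then have "(1::real) \<le> 2 ^ card (B \<inter> G) / 2 ^ L" by (simp add: power_increasing)
    then show ?thesis using True by simp
  qed simp
next
  case (Suc r B)
  let ?C = "\<Prod>i\<in>{1..r}. 1 + q i"
  let ?b = "2 ^ card (B \<inter> G) / 2 ^ L * ?C"
  have C1: "1 \<le> ?C" using q0 by (intro prod_ge_1) simp
  have C2: "(\<Prod>i\<in>{1..Suc r}. 1 + q i) = ?C * (1 + q (Suc r))" by simp
  show ?case
  proof (cases "stop (Suc r) (card (B \<inter> G))")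
    case True
    show ?thesis
    \<comment> \<open>At a stopped state no step bound is available. Either \<open>E\<close> has
      become unreachable, or the stopping hypothesis gives at least \<open>L\<close> hits, so that
      the claimed bound is at least 1.\<close>
    proof (cases "set_pmf (gen_steps n P (Suc r) B) \<inter> E = {}")
      case True
      then have "measure_pmf.prob (gen_steps n P (Suc r) B) E = 0"
        by (simp add: measure_pmf_zero_iff)
      then show ?thesis using q0 by (simp add: prod_nonneg add_nonneg_nonneg)
    next
      case False
      then obtain X where X: "X \<in> set_pmf (gen_steps n P (Suc r) B)" "X \<in> E" by auto
      then have "L \<le> card (B \<inter> G)"
        using stop[OF Suc.prems] \<open>stop (Suc r) (card (B \<inter> G))\<close> set_gen_steps[OF Suc.prems X(1)] by auto
      then have "(1::real) \<le> 2 ^ card (B \<inter> G) / 2 ^ L" by (simp add: power_increasing)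
      moreover have "1 \<le> (\<Prod>i\<in>{1..Suc r}. 1 + q i)" using q0 by (intro prod_ge_1) simp
      ultimately have "1 \<le> 2 ^ card (B \<inter> G) / 2 ^ L * (\<Prod>i\<in>{1..Suc r}. 1 + q i)"
        using mult_mono[of 1 _ 1] by (smt (verit) mult_cancel_left2)
      then show ?thesis using measure_pmf.prob_le_1 order_trans by blast
    qed
  next
    case False
    have finB: "finite B" using reach_finite[OF Suc.prems n3] .
    have b0: "0 \<le> ?b" using C1 by simp
    \<comment> \<open>A draw from \<open>G\<close> adds one hit and doubles the bound
      \<open>?b\<close> of the induction hypothesis; any other draw leaves it unchanged.\<close>
    have "measure_pmf.prob (gen_steps n P (Suc r) B) E \<le> ?b + (2 * ?b - ?b) * q (Suc r)"
      unfolding gen_steps_Suc[OF Suc.prems]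
    proof (rule prob_bind_pmf_le[where G = G])
      fix e assume e: "e \<in> set_pmf (W B)" "e \<notin> G"
      then have ad: "e \<in> admissible n B" using set_W[OF Suc.prems] by auto
      have "insert e B \<inter> G = B \<inter> G" using e by auto
      then show "measure_pmf.prob (gen_steps n P r (insert e B)) E \<le> ?b"
        using Suc.IH[OF reach_insert[OF Suc.prems ad n3]] by simp
    next
      fix e assume e: "e \<in> set_pmf (W B)" "e \<in> G"
      then have ad: "e \<in> admissible n B" using set_W[OF Suc.prems] by auto
      then have "e \<notin> B" by (simp add: admissible_def)
      then have "card (insert e B \<inter> G) = Suc (card (B \<inter> G))" using e finB by simp
      then show "measure_pmf.prob (gen_steps n P r (insert e B)) E \<le> 2 * ?b"
        using Suc.IH[OF reach_insert[OF Suc.prems ad n3]] by simp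
    next
      show "?b \<le> 2 * ?b" using b0 by simp
      show "measure_pmf.prob (W B) G \<le> q (Suc r)" using q[OF Suc.prems _ False] by simp
    qed
    also have "\<dots> = ?b * (1 + q (Suc r))" by algebra
    also have "\<dots> = 2 ^ card (B \<inter> G) / 2 ^ L * (\<Prod>i\<in>{1..Suc r}. 1 + q i)"
      unfolding C2 by (simp only: mult.assoc)
    finally show ?thesis .
  qed
qed

end

section \<open>Weights of the two kinds of matrices\<close>

lemma edge_weight_symmetric:
  assumes "e \<in> kn_edges n" "\<And>i j. P i j = P j i"
  obtains i j where "i \<noteq> j" "e = {i, j}" "edge_weight P e = 2 * P i j"
proof -
  obtain i j where ij: "e = {i, j}" "i \<noteq> j" using assms(1) unfolding kn_edges_def by blast
  then have "edge_weight P e = 2 * P i j"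
    using assms(2)[of i j] by (cases "i < j") (auto simp: edge_weight_def)
  then show thesis using that ij by blast
qed

lemma edge_weight_Pi0:
  assumes "e \<in> kn_edges n" shows "edge_weight (Pi0 n) e = 2 / (real n - 1)"
proof -
  have "Pi0 n i j = Pi0 n j i" for i j by (simp add: Pi0_def)
  from edge_weight_symmetric[OF assms, of "Pi0 n", OF this] show ?thesis by (auto simp: Pi0_def)
qed

lemma edge_weight_PiH:
  assumes "e \<in> kn_edges n"
  shows "edge_weight (PiH n H) e =
    2 * (if e \<in> H then 1 - 1 / real n else 1 / (real n * (real n - 2)))"
proof -
  have "PiH n H i j = PiH n H j i" for i j by (simp add: PiH_def insert_commute)
  from edge_weight_symmetric[OF assms, of "PiH n H", OF this]
  obtain i j where "i \<noteq> j" "e = {i, j}" "edge_weight (PiH n H) e = 2 * PiH n H i j" .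
  then show ?thesis by (simp add: PiH_def)
qed

lemma gen_Pi0: "3 \<le> n \<Longrightarrow> gen n (Pi0 n)"
  by unfold_locales (auto simp: edge_weight_Pi0)

lemma gen_PiH: "3 \<le> n \<Longrightarrow> gen n (PiH n H)"
  by unfold_locales (auto simp: edge_weight_PiH)

lemma sum_Int_const:
  assumes "finite A" "\<And>x. x \<in> A \<Longrightarrow> x \<in> G \<Longrightarrow> w x = c"
  shows "sum w (A \<inter> G) = real (card (A \<inter> G)) * c"
proof -
  have "sum w (A \<inter> G) = (\<Sum>x\<in>A \<inter> G. c)" using assms(2) by (intro sum.cong) auto
  then show ?thesis by simp
qed

text \<open>\<open>a\<close> and \<open>b\<close> are half the total weights of the admissible edges
  outside and inside \<open>H\<close>; the factor 2 from symmetrising the matrix cancels.\<close>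

lemma prob_W_PiH:
  fixes H :: "nat set set"
  assumes n3: "3 \<le> n" and r: "reach n r B" "0 < r"
  defines "a \<equiv> real (card (admissible n B \<inter> - H)) * (1 / (real n * (real n - 2)))"
    and "b \<equiv> real (card (admissible n B \<inter> H)) * (1 - 1 / real n)"
  shows "measure_pmf.prob (weighted_pmf (admissible n B) (edge_weight (PiH n H))) (- H) = a / (a + b)"
    and "measure_pmf.prob (weighted_pmf (admissible n B) (edge_weight (PiH n H))) H = b / (a + b)"
proof -
  interpret gen n "PiH n H" by (rule gen_PiH[OF n3])
  let ?w = "edge_weight (PiH n H)" and ?A = "admissible n B"
  have kn: "e \<in> kn_edges n" if "e \<in> ?A" for e using that by (simp add: admissible_def)
  have 1: "sum ?w (?A \<inter> - H) = 2 * a"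
    using sum_Int_const[of ?A "- H" ?w "2 * (1 / (real n * (real n - 2)))"] edge_weight_PiH kn
    by (simp add: a_def)
  have 2: "sum ?w (?A \<inter> H) = 2 * b"
    using sum_Int_const[of ?A H ?w "2 * (1 - 1 / real n)"] edge_weight_PiH kn
    by (simp add: b_def)
  have "?A = (?A \<inter> - H) \<union> (?A \<inter> H)" by auto
  then have "sum ?w ?A = sum ?w ((?A \<inter> - H) \<union> (?A \<inter> H))" by simp
  also have "\<dots> = sum ?w (?A \<inter> - H) + sum ?w (?A \<inter> H)" by (rule sum.union_disjoint) auto
  finally have 3: "sum ?w ?A = 2 * (a + b)" using 1 2 by simp
  show "measure_pmf.prob (W B) (- H) = a / (a + b)" "measure_pmf.prob (W B) H = b / (a + b)"
    unfolding prob_W[OF r] 1 2 3 by (simp_all only: mult_divide_mult_cancel_left_if) simp_all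
qed

lemma prod_one_plus_le_exp:
  fixes q :: "'a \<Rightarrow> real"
  assumes "\<And>i. i \<in> I \<Longrightarrow> 0 \<le> q i"
  shows "(\<Prod>i\<in>I. 1 + q i) \<le> exp (\<Sum>i\<in>I. q i)"
proof (cases "finite I")
  case True
  have "(\<Prod>i\<in>I. 1 + q i) \<le> (\<Prod>i\<in>I. exp (q i))"
    using assms by (intro prod_mono) (auto simp: exp_ge_add_one_self add.commute add_nonneg_nonneg)
  then show ?thesis using True by (simp add: exp_sum)
qed simp

text \<open>Let d be the number of foreign edges so far. While r > 8d, at least r/2 edges of
  \<open>H\<close> of weight almost 1 compete with at most 2r^2 foreign ones of weight about 1/n^2,
  so a foreign draw has probability at most 8r/n^2; these sum to 4(n+1)/n <= 5, whence
  \<open>exp 5\<close>. Once r <= 8d, the final tour has at most d + r <= 9d foreign edges, whence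
  the factor 9.\<close>

lemma generate_far_from_ham:
  assumes n: "6 \<le> n" and H: "ham_cycle n H"
  shows "measure_pmf.prob (generate n (PiH n H)) {X. 9 * L < card (X - H)} \<le> exp 5 / 2 ^ L"
proof -
  have n3: "3 \<le> n" using n by simp
  interpret gen n "PiH n H" by (rule gen_PiH[OF n3])
  obtain h where h: "ham n h H" using ham_cycle_ham[OF H n3] by blast
  define q where "q r = 8 * real r / (real n)\<^sup>2" for r
  have "measure_pmf.prob (gen_steps n (PiH n H) n {}) {X. 9 * L < card (X - H)}
      \<le> 2 ^ card ({} \<inter> - H) / 2 ^ L * (\<Prod>i\<in>{1..n}. 1 + q i)"
  proof (rule gen_steps_tail[where G = "- H" and stop = "\<lambda>r d. r \<le> 8 * d", OF _ _ _ reach_empty[OF n3]])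
    fix r B assume r: "reach n r B" "0 < r" "\<not> r \<le> 8 * card (B \<inter> - H)"
    obtain S where S: "path_sys n S B" "card S = r" "card B + r = n" using reach_pos[OF r(1,2)] by auto
    interpret path_sys n S B by (rule S)
    define a where "a = real (card (admissible n B \<inter> - H)) * (1 / (real n * (real n - 2)))"
    define b where "b = real (card (admissible n B \<inter> H)) * (1 - 1 / real n)"
    have "card S \<le> card (admissible n B \<inter> H) + 4 * card (B - H)"
      using card_admissible_ham[OF h] S by simp
    moreover have "B - H = B \<inter> - H" by auto
    ultimately have "r \<le> 2 * card (admissible n B \<inter> H)" using r(3) S(2) by simp
    then have "real r / 2 * (1 - 1 / real n) \<le> b" unfolding b_def using n by (intro mult_right_mono) auto
    then have b: "real r / 2 * ((real n - 1) / real n) \<le> b" using n by (simp add: diff_divide_distrib)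
    have b0: "0 < real r / 2 * ((real n - 1) / real n)" using n r(2) by simp
    have "card (admissible n B \<inter> - H) \<le> 2 * r\<^sup>2"
      using card_admissible_le S(2) card_mono[of "admissible n B" "admissible n B \<inter> - H"] by simp
    then have "real (card (admissible n B \<inter> - H)) \<le> 2 * (real r)\<^sup>2"
      by (metis of_nat_le_iff of_nat_mult of_nat_numeral of_nat_power)
    then have a: "a \<le> 2 * (real r)\<^sup>2 * (1 / (real n * (real n - 2)))"
      unfolding a_def using n by (intro mult_right_mono) auto
    have a0: "0 \<le> a" unfolding a_def using n by simp
    have "measure_pmf.prob (W B) (- H) = a / (a + b)"
      using prob_W_PiH(1)[OF n3 r(1,2), of H] by (simp add: a_def b_def)
    also have "\<dots> \<le> a / b" using a0 b b0 by (intro divide_left_mono) auto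
    also have "\<dots> \<le> (2 * (real r)\<^sup>2 * (1 / (real n * (real n - 2)))) / (real r / 2 * ((real n - 1) / real n))"
      using a a0 b b0 by (intro frac_le) auto
    also have "\<dots> = 4 * real r / ((real n - 1) * (real n - 2))"
    proof -
      have "(2 * t\<^sup>2 * (1 / (m * y))) / (t / 2 * (x / m)) = 4 * t / (x * y)"
        if "t \<noteq> 0" "m \<noteq> 0" "x \<noteq> 0" "y \<noteq> 0" for t m x y :: real
        using that by (simp add: power2_eq_square field_simps)
      from this[of "real r" "real n" "real n - 1" "real n - 2"] show ?thesis using n r(2) by (simp del: times_divide_eq_right times_divide_eq_left divide_divide_eq_left)
    qed
    also have "\<dots> \<le> 4 * real r / ((real n)\<^sup>2 / 2)"
    proof (intro divide_left_mono)
      have "6 * real n \<le> real n * real n" using n by (intro mult_right_mono) auto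
      moreover have "(real n - 1) * (real n - 2) = real n * real n - 3 * real n + 2"
        by (simp add: algebra_simps)
      ultimately show "(real n)\<^sup>2 / 2 \<le> (real n - 1) * (real n - 2)"
        by (simp add: power2_eq_square)
    qed (use n in auto)
    finally show "measure_pmf.prob (W B) (- H) \<le> q r" by (simp add: q_def)
  next
    show "0 \<le> q r" for r by (simp add: q_def)
  next
    fix r B X assume r: "reach n r B" "r = 0 \<or> r \<le> 8 * card (B \<inter> - H)" "B \<subseteq> X" "ham_cycle n X"
      "X \<in> {X. 9 * L < card (X - H)}"
    have X: "card X = n" "finite X" using ham_cycle_facts[OF r(4) n3] by auto
    have finB: "finite B" using X r(3) finite_subset by blast
    have "card (X - B) = r" using reach_card[OF r(1) n3] X r(3) finB by (simp add: card_Diff_subset)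
    have "card (X - H) \<le> card ((B \<inter> - H) \<union> (X - B))" using X finB by (intro card_mono) auto
    also have "\<dots> \<le> card (B \<inter> - H) + card (X - B)" by (rule card_Un_le)
    finally have "card (X - H) \<le> card (B \<inter> - H) + r" using \<open>card (X - B) = r\<close> by simp
    then show "L \<le> card (B \<inter> - H)" using r(2,5) by auto
  qed
  also have "(\<Prod>i\<in>{1..n}. 1 + q i) \<le> exp (\<Sum>i\<in>{1..n}. q i)"
    by (rule prod_one_plus_le_exp) (simp add: q_def)
  also have "(\<Sum>i\<in>{1..n}. q i) \<le> 5"
  proof -
    have "(\<Sum>i\<in>{1..n}. q i) = 8 / (real n)\<^sup>2 * (\<Sum>i\<in>{1..n}. real i)"
      by (simp add: q_def sum_distrib_left)
    also have "(\<Sum>i\<in>{1..n}. real i) = real n * (real n + 1) / 2"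
      by (induction n) (auto simp: field_simps)
    also have "8 / (real n)\<^sup>2 * (real n * (real n + 1) / 2) \<le> 5"
      using n by (simp add: power2_eq_square field_simps)
    finally show ?thesis .
  qed
  finally show ?thesis by (simp add: generate_def divide_right_mono)
qed

text \<open>The pairs among more than n/2 paths number at least (n^2 - 1)/8; passing from 8 to 9
  absorbs the lower-order term.\<close>

lemma quadratic_count_bound:
  assumes "n div 2 < r" "10 \<le> n" shows "(real n)\<^sup>2 / 9 \<le> real (r * (r - 1) div 2)"
proof -
  have r: "real n + 1 \<le> 2 * real r" using assms by linarith
  have "even (r * (r - 1))" by auto
  then have "real (r * (r - 1) div 2) = real (r * (r - 1)) / 2" by (simp add: real_of_nat_div)
  also have "\<dots> = real r * (real r - 1) / 2" using assms by (simp add: of_nat_diff)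
  also have "\<dots> \<ge> ((real n + 1) / 2) * ((real n - 1) / 2) / 2"
    using r assms by (intro divide_right_mono mult_mono) auto
  also have "((real n + 1) / 2) * ((real n - 1) / 2) / 2 = ((real n)\<^sup>2 - 1) / 8"
    by (simp add: power2_eq_square algebra_simps)
  moreover have "(real n)\<^sup>2 / 9 \<le> ((real n)\<^sup>2 - 1) / 8"
    using power_mono[of 10 "real n" 2] assms by simp
  ultimately show ?thesis by linarith
qed

text \<open>In the first half of the generation at least n^2/9 equally likely edges are admissible,
  at most n of them in \<open>s\<close>, so each draw hits \<open>s\<close> with probability at most
  9/n; summed over at most n steps this gives \<open>exp 9\<close>. The last \<open>n div 2\<close>
  edges are all counted as hits, which explains the exponent.\<close>

lemma generate_Pi0_overlap:
  assumes n: "10 \<le> n" and s: "finite s" "card s \<le> n"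
  shows "measure_pmf.prob (generate n (Pi0 n)) {X. n - K \<le> card (X \<inter> s)}
    \<le> exp 9 / 2 ^ (n - K - n div 2)"
proof -
  have n3: "3 \<le> n" using n by simp
  interpret gen n "Pi0 n" by (rule gen_Pi0[OF n3])
  define q :: "nat \<Rightarrow> real" where "q r = 9 / real n" for r
  let ?L = "n - K - n div 2"
  have "measure_pmf.prob (gen_steps n (Pi0 n) n {}) {X. n - K \<le> card (X \<inter> s)}
      \<le> 2 ^ card ({} \<inter> s) / 2 ^ ?L * (\<Prod>i\<in>{1..n}. 1 + q i)"
  proof (rule gen_steps_tail[where G = s and stop = "\<lambda>r d. r \<le> n div 2", OF _ _ _ reach_empty[OF n3]])
    fix r B assume r: "reach n r B" "0 < r" "\<not> r \<le> n div 2"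
    obtain S where S: "path_sys n S B" "card S = r" "card B + r = n" using reach_pos[OF r(1,2)] by auto
    interpret path_sys n S B by (rule S)
    let ?A = "admissible n B"
    have kn: "e \<in> kn_edges n" if "e \<in> ?A" for e using that by (simp add: admissible_def)
    have "(real n)\<^sup>2 / 9 \<le> real (card ?A)"
      using quadratic_count_bound[of n r] r(3) n card_admissible_ge S(2) by simp
    moreover have "real (card (?A \<inter> s)) \<le> real n" using s card_mono[of s "?A \<inter> s"] by simp
    moreover have "measure_pmf.prob (W B) s = real (card (?A \<inter> s)) / real (card ?A)"
      unfolding prob_W[OF r(1,2)]
      using sum_Int_const[of ?A s "edge_weight (Pi0 n)" "2 / (real n - 1)"]
        sum_Int_const[of ?A UNIV "edge_weight (Pi0 n)" "2 / (real n - 1)"] edge_weight_Pi0 kn n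
      by simp
    ultimately have "measure_pmf.prob (W B) s \<le> real n / ((real n)\<^sup>2 / 9)"
      using n by (simp only: frac_le zero_less_divide_iff of_nat_0_le_iff) (intro frac_le; simp)
    also have "\<dots> = 9 / real n" using n by (simp add: power2_eq_square)
    finally show "measure_pmf.prob (W B) s \<le> q r" by (simp add: q_def)
  next
    show "0 \<le> q r" for r by (simp add: q_def)
  next
    fix r B X assume r: "reach n r B" "r = 0 \<or> r \<le> n div 2" "B \<subseteq> X" "ham_cycle n X"
      "X \<in> {X. n - K \<le> card (X \<inter> s)}"
    have X: "card X = n" "finite X" using ham_cycle_facts[OF r(4) n3] by auto
    have finB: "finite B" using X r(3) finite_subset by blast
    have "card (X - B) = r" using reach_card[OF r(1) n3] X r(3) finB by (simp add: card_Diff_subset)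
    have "card (X \<inter> s) \<le> card ((B \<inter> s) \<union> (X - B))" using X finB by (intro card_mono) auto
    also have "\<dots> \<le> card (B \<inter> s) + card (X - B)" by (rule card_Un_le)
    finally have "card (X \<inter> s) \<le> card (B \<inter> s) + r" using \<open>card (X - B) = r\<close> by simp
    then show "?L \<le> card (B \<inter> s)" using r(2,5) by auto
  qed
  also have "(\<Prod>i\<in>{1..n}. 1 + q i) \<le> exp (\<Sum>i\<in>{1..n}. q i)"
    by (rule prod_one_plus_le_exp) (simp add: q_def)
  also have "(\<Sum>i\<in>{1..n}. q i) = 9" using n by (simp add: q_def)
  finally show ?thesis by (simp add: generate_def divide_right_mono)
qed

text \<open>In the first half, at least n^2/9 - n foreign edges are admissible, with total weight
  \<open>a\<close> at least 1/10 (this uses that n is large), against a total weight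
  \<open>b\<close> of at most n for the edges of \<open>H\<close>.\<close>

lemma prob_W_PiH_stay:
  assumes n: "100 \<le> n" and H: "card H = n" "finite H" and r: "reach n r B" "n div 2 < r"
  shows "measure_pmf.prob (weighted_pmf (admissible n B) (edge_weight (PiH n H))) H
    \<le> 1 - 1 / (16 * real n)"
proof -
  have n3: "3 \<le> n" using n by simp
  have r0: "0 < r" using r by simp
  obtain S where S: "path_sys n S B" "card S = r" using reach_pos[OF r(1) r0] by auto
  interpret path_sys n S B by (rule S)
  let ?A = "admissible n B"
  define a where "a = real (card (?A \<inter> - H)) * (1 / (real n * (real n - 2)))"
  define b where "b = real (card (?A \<inter> H)) * (1 - 1 / real n)"
  have AH: "card (?A \<inter> H) \<le> n" using H card_mono[of H "?A \<inter> H"] by simp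
  have "b \<le> real n * 1" unfolding b_def using AH n by (intro mult_mono) auto
  then have b: "b \<le> real n" by simp
  have b0: "0 \<le> b" unfolding b_def using n by simp
  have "(real n)\<^sup>2 / 9 \<le> real (card ?A)"
    using quadratic_count_bound[of n r] r(2) n card_admissible_ge S(2) by simp
  moreover have "card ?A = card (?A \<inter> - H) + card (?A \<inter> H)"
    by (subst card_Un_disjoint[symmetric]) (auto intro!: arg_cong[where f = card])
  ultimately have "(real n)\<^sup>2 / 9 - real n \<le> real (card (?A \<inter> - H))" using AH by simp
  then have "((real n)\<^sup>2 / 9 - real n) * (1 / (real n * (real n - 2))) \<le> a"
    unfolding a_def using n by (intro mult_right_mono) auto
  also have "((real n)\<^sup>2 / 9 - real n) * (1 / (real n * (real n - 2))) = (real n / 9 - 1) / (real n - 2)"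
    using n by (simp add: power2_eq_square field_simps)
  finally have a: "(real n / 9 - 1) / (real n - 2) \<le> a" .
  have "1 / 10 \<le> (real n / 9 - 1) / (real n - 2)" using n by (simp add: field_simps)
  then have a: "1 / 10 \<le> a" using a by (rule order_trans)
  have "(16 * real n - 1) * (1 / 10) \<le> (16 * real n - 1) * a" using a n by (intro mult_left_mono) auto
  moreover have "b \<le> (16 * real n - 1) * (1 / 10)" using b n by simp
  ultimately have "b \<le> (16 * real n - 1) * a" by (rule order_trans[rotated])
  then have "a + b \<le> a * (16 * real n)" by (simp add: algebra_simps)
  then have "1 / (16 * real n) \<le> a / (a + b)" using a b0 n by (simp add: field_simps)
  moreover have "b / (a + b) = 1 - a / (a + b)" using a b0 by (simp add: field_simps)
  ultimately show ?thesis
    using prob_W_PiH(2)[OF n3 r(1) r0, of H] by (simp add: a_def b_def)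
qed

text \<open>Reproducing \<open>H\<close> requires every draw to stay in \<open>H\<close>. Over the
  n/2 draws of the first half this has probability at most (1 - 1/(16n))^(n/2) <= exp (- 1/32) <=
  32/33.\<close>

lemma generate_same_ham:
  assumes n: "100 \<le> n" and H: "ham_cycle n H"
  shows "measure_pmf.prob (generate n (PiH n H)) {H} \<le> 32 / 33"
proof -
  have n3: "3 \<le> n" using n by simp
  interpret gen n "PiH n H" by (rule gen_PiH[OF n3])
  let ?c = "1 - 1 / (16 * real n)"
  have c: "0 \<le> ?c" "?c \<le> 1" using n by auto
  \<comment> \<open>The exponent counts the remaining draws of the first half; truncated subtraction
    makes the bound 1 afterwards.\<close>
  have gen: "reach n r B \<Longrightarrow> measure_pmf.prob (gen_steps n (PiH n H) r B) {H} \<le> ?c ^ (r - n div 2)"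
    for r B
  proof (induction r arbitrary: B)
    case (Suc r B)
    show ?case
    proof (cases "n div 2 < Suc r")
      case True
      have "measure_pmf.prob (gen_steps n (PiH n H) (Suc r) B) {H} \<le> 0 + (?c ^ (r - n div 2) - 0) * ?c"
        unfolding gen_steps_Suc[OF Suc.prems]
      proof (rule prob_bind_pmf_le[where G = H])
        fix e assume e: "e \<in> set_pmf (W B)" "e \<notin> H"
        then have ad: "e \<in> admissible n B" using set_W[OF Suc.prems] by auto
        \<comment> \<open>Edges are never removed, so a run that has left \<open>H\<close> cannot
          end in \<open>H\<close>.\<close>
        have "H \<notin> set_pmf (gen_steps n (PiH n H) r (insert e B))"
          using set_gen_steps[OF reach_insert[OF Suc.prems ad n3]] e by blast
        then show "measure_pmf.prob (gen_steps n (PiH n H) r (insert e B)) {H} \<le> 0"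
          by (simp add: measure_pmf_single set_pmf_iff)
      next
        fix e assume e: "e \<in> set_pmf (W B)" "e \<in> H"
        then have ad: "e \<in> admissible n B" using set_W[OF Suc.prems] by auto
        show "measure_pmf.prob (gen_steps n (PiH n H) r (insert e B)) {H} \<le> ?c ^ (r - n div 2)"
          by (rule Suc.IH[OF reach_insert[OF Suc.prems ad n3]])
      next
        show "0 \<le> ?c ^ (r - n div 2)" using c by simp
        show "measure_pmf.prob (W B) H \<le> ?c"
          using prob_W_PiH_stay[OF n _ _ Suc.prems True] ham_cycle_facts[OF H n3] by simp
      qed
      also have "\<dots> = ?c ^ (Suc r - n div 2)" using True by (simp add: Suc_diff_le less_Suc_eq_le)
      finally show ?thesis .
    qed (simp del: gen_steps.simps)
  qed simp
  have "measure_pmf.prob (generate n (PiH n H)) {H} \<le> ?c ^ (n - n div 2)"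
    unfolding generate_def by (rule gen[OF reach_empty[OF n3]])
  also have "\<dots> \<le> exp (- (1 / (16 * real n))) ^ (n - n div 2)"
    using c(1) exp_ge_add_one_self[of "- (1 / (16 * real n))"] by (intro power_mono) auto
  also have "\<dots> = exp (- (real (n - n div 2) / (16 * real n)))" by (simp add: exp_of_nat_mult[symmetric])
  also have "\<dots> \<le> exp (- (1 / 32))"
  proof -
    have "real n / 2 \<le> real (n - n div 2)" by linarith
    then show ?thesis using n by (simp add: field_simps)
  qed
  also have "\<dots> \<le> 32 / 33" using exp_ge_add_one_self[of "1 / 32 :: real"] by (simp add: exp_minus field_simps)
  finally show ?thesis .
qed

section \<open>Rotational symmetry\<close>

lemma map_weighted_pmf:
  assumes "finite A" "A \<noteq> {}" "\<And>x. x \<in> A \<Longrightarrow> 0 < w x" "bij f"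
    and "\<And>x. x \<in> A \<Longrightarrow> w' (f x) = w x"
  shows "map_pmf f (weighted_pmf A w) = weighted_pmf (f ` A) w'"
proof (rule pmf_eqI)
  fix y
  obtain x where y: "y = f x" using assms(4) by (metis bij_pointE)
  have inj: "inj f" using assms(4) by (rule bij_is_inj)
  have s: "sum w' (f ` A) = sum w A"
    using assms(5) inj by (subst sum.reindex) (auto simp: inj_on_def inj_def)
  have "pmf (map_pmf f (weighted_pmf A w)) y = pmf (weighted_pmf A w) x"
    unfolding y by (rule pmf_map_inj'[OF inj])
  also have "\<dots> = (if x \<in> A then w x / sum w A else 0)"
    by (rule pmf_weighted_pmf) (use assms in auto)
  also have "\<dots> = (if y \<in> f ` A then w' y / sum w' (f ` A) else 0)"
    using assms(5) inj s by (auto simp: y inj_def)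
  also have "\<dots> = pmf (weighted_pmf (f ` A) w') y"
    by (rule pmf_weighted_pmf[symmetric]) (use assms in auto)
  finally show "pmf (map_pmf f (weighted_pmf A w)) y = pmf (weighted_pmf (f ` A) w') y" .
qed

text \<open>\<sigma> permutes all natural numbers, not just the vertices, so that its images on
  edges and edge sets are injective without any domain condition.\<close>

locale relabelling =
  fixes n :: nat and \<sigma> :: "nat \<Rightarrow> nat"
  assumes bij: "bij \<sigma>" and verts: "\<sigma> ` verts n = verts n"
begin

abbreviation relabel :: "nat set set \<Rightarrow> nat set set" where
  "relabel B \<equiv> image \<sigma> ` B"

lemma inj: "inj \<sigma>" using bij by (rule bij_is_inj)

lemma inj_image_edge: "inj (image \<sigma>)" using inj by (rule inj_image_eq_iff[THEN iffD1, OF _ , THEN injI])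

lemma image_in_relabel: "\<sigma> ` e \<in> relabel B \<longleftrightarrow> e \<in> B"
  using inj by (simp add: inj_image_mem_iff inj_image_edge)

lemma kn_edges_image:
  assumes "e \<in> kn_edges n" shows "\<sigma> ` e \<in> kn_edges n"
proof -
  obtain i j where "e = {i, j}" "i \<in> verts n" "j \<in> verts n" "i \<noteq> j"
    using assms unfolding kn_edges_def by blast
  then have "\<sigma> ` e = {\<sigma> i, \<sigma> j}" "\<sigma> i \<in> verts n" "\<sigma> j \<in> verts n" "\<sigma> i \<noteq> \<sigma> j"
    using verts inj by (auto simp: inj_def)
  then show ?thesis unfolding kn_edges_def by blast
qed

lemma degree_relabel: "degree (relabel B) (\<sigma> v) = degree B v"
proof -
  have "{e \<in> relabel B. \<sigma> v \<in> e} = image \<sigma> ` {e \<in> B. v \<in> e}"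
    using inj_image_mem_iff[OF inj] by auto
  moreover have "inj_on (image \<sigma>) {e \<in> B. v \<in> e}" using inj_image_edge by (rule inj_on_subset) simp
  ultimately show ?thesis unfolding degree_def by (simp add: card_image)
qed

lemma has_cycle_len_relabel:
  assumes "has_cycle_len n B k" shows "has_cycle_len n (relabel B) k"
proof -
  obtain p where p: "3 \<le> k" "inj_on p {..<k}" "p ` {..<k} \<subseteq> verts n"
    "\<And>i. i < k \<Longrightarrow> {p i, p ((i + 1) mod k)} \<in> B"
    using assms unfolding has_cycle_len_def by blast
  have "inj_on (\<sigma> \<circ> p) {..<k}" using p(2) inj by (intro comp_inj_on) (auto simp: inj_on_def inj_def)
  moreover have "(\<sigma> \<circ> p) ` {..<k} \<subseteq> verts n" using p(3) verts by auto
  moreover have "{(\<sigma> \<circ> p) i, (\<sigma> \<circ> p) ((i + 1) mod k)} \<in> relabel B" if "i < k" for i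
    using imageI[OF p(4)[OF that], of "image \<sigma>"] by simp
  ultimately show ?thesis using p(1) unfolding has_cycle_len_def by blast
qed

lemma inverse: "relabelling n (inv \<sigma>)"
proof
  show "bij (inv \<sigma>)" using bij by (rule bij_imp_bij_inv)
  show "inv \<sigma> ` verts n = verts n"
    using inj verts by (metis image_inv_f_f)
qed

lemma relabel_inv: "image (inv \<sigma>) ` relabel B = B"
  using inj by (simp add: image_image image_inv_f_f)

lemma has_cycle_len_relabel_iff: "has_cycle_len n (relabel B) k \<longleftrightarrow> has_cycle_len n B k"
proof
  assume "has_cycle_len n (relabel B) k"
  then have "has_cycle_len n (image (inv \<sigma>) ` relabel B) k"
    by (rule relabelling.has_cycle_len_relabel[OF inverse])
  then show "has_cycle_len n B k" by (simp only: relabel_inv)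
qed (rule has_cycle_len_relabel)

lemma admissible_image:
  assumes "e \<in> admissible n B" shows "\<sigma> ` e \<in> admissible n (relabel B)"
proof -
  have ins: "insert (\<sigma> ` e) (relabel B) = relabel (insert e B)" by simp
  have "degree (insert (\<sigma> ` e) (relabel B)) v < 3" if "v \<in> verts n" for v
  proof -
    have "v \<in> \<sigma> ` verts n" using that by (simp only: verts)
    then obtain u where u: "v = \<sigma> u" "u \<in> verts n" by (rule imageE)
    then have "degree (insert e B) u < 3" using assms by (simp add: admissible_def)
    then show ?thesis unfolding ins u(1) degree_relabel .
  qed
  moreover have "\<not> has_cycle_len n (insert (\<sigma> ` e) (relabel B)) k" if "k < n" for k
    unfolding ins has_cycle_len_relabel_iff using assms that by (simp add: admissible_def)
  ultimately show ?thesis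
    using assms kn_edges_image image_in_relabel by (simp add: admissible_def)
qed

text \<open>One inclusion suffices: the other is the same statement for the inverse
  permutation.\<close>

lemma admissible_relabel: "admissible n (relabel B) = image \<sigma> ` admissible n B"
proof
  show "image \<sigma> ` admissible n B \<subseteq> admissible n (relabel B)" using admissible_image by auto
  show "admissible n (relabel B) \<subseteq> image \<sigma> ` admissible n B"
  proof
    fix e assume "e \<in> admissible n (relabel B)"
    then have "inv \<sigma> ` e \<in> admissible n (image (inv \<sigma>) ` relabel B)"
      by (rule relabelling.admissible_image[OF inverse])
    then have "inv \<sigma> ` e \<in> admissible n B" by (simp only: relabel_inv)
    moreover have "e = \<sigma> ` (inv \<sigma> ` e)" using bij by (simp add: bij_is_surj image_f_inv_f)
    ultimately show "e \<in> image \<sigma> ` admissible n B" by blast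
  qed
qed

text \<open>Admissibility is preserved by relabelling and the weights are \<sigma>-invariant, so
  drawing an edge and then relabelling has the same law as drawing from the relabelled state.
  Induction carries this through all steps.\<close>

lemma map_gen_steps:
  assumes "gen n P" and w: "\<And>e. e \<in> kn_edges n \<Longrightarrow> edge_weight P (\<sigma> ` e) = edge_weight P e"
  shows "reach n r B \<Longrightarrow> map_pmf relabel (gen_steps n P r B) = gen_steps n P r (relabel B)"
proof (induction r arbitrary: B)
  case (Suc r B)
  interpret gen n P by fact
  have bij_e: "bij (image \<sigma>)"
  proof (rule bijI[OF inj_image_edge])
    show "surj (image \<sigma>)" using bij by (metis bij_is_surj image_f_inv_f surjI)
  qed
  have "card (relabel B) = card B" by (rule card_image[OF inj_on_subset[OF inj_image_edge subset_UNIV]])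
  then have "card (relabel B) \<noteq> n" using reach_card[OF Suc.prems n3] by simp
  then have nh: "\<not> ham_cycle n (relabel B)" using ham_cycle_facts(1) n3 by blast
  have mapW: "map_pmf (image \<sigma>) (W B) = W (relabel B)"
    unfolding admissible_relabel
  proof (rule map_weighted_pmf[OF finite_admissible reach_admissible[OF Suc.prems] _ bij_e])
    show "0 < Suc r" by simp
    show "0 < edge_weight P x" if "x \<in> admissible n B" for x using admissible_weight_pos that .
    show "edge_weight P (\<sigma> ` x) = edge_weight P x" if "x \<in> admissible n B" for x
      using w that by (simp add: admissible_def)
  qed
  have "map_pmf relabel (gen_steps n P (Suc r) B)
      = bind_pmf (W B) (\<lambda>e. map_pmf relabel (gen_steps n P r (insert e B)))"
    unfolding gen_steps_Suc[OF Suc.prems] by (rule map_bind_pmf)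
  also have "\<dots> = bind_pmf (W B) (\<lambda>e. gen_steps n P r (insert (\<sigma> ` e) (relabel B)))"
  proof (rule bind_pmf_cong[OF refl])
    fix e assume "e \<in> set_pmf (W B)"
    then have "e \<in> admissible n B" using set_W[OF Suc.prems] by auto
    from Suc.IH[OF reach_insert[OF Suc.prems this n3]]
    show "map_pmf relabel (gen_steps n P r (insert e B)) = gen_steps n P r (insert (\<sigma> ` e) (relabel B))"
      by simp
  qed
  also have "\<dots> = bind_pmf (map_pmf (image \<sigma>) (W B)) (\<lambda>e. gen_steps n P r (insert e (relabel B)))"
    by (simp add: bind_map_pmf)
  also have "\<dots> = gen_steps n P (Suc r) (relabel B)" using nh mapW by simp
  finally show ?case .
qed simp

end

text \<open>Finite support makes every real function integrable, which settles the integrability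
  conditions for expectations over a sampled tour and, via \<open>finite_set_samples\<close>, over
  the iteration best.\<close>

lemma (in gen) finite_set_generate: "finite (set_pmf (generate n P))"
  by (rule finite_subset[of _ "Pow (kn_edges n)"]) (use set_generate ham_cycle_facts(3) n3 in auto)

section \<open>Rotations of a tour and single-edge probabilities\<close>

context ham begin

text \<open>Shift by \<open>j\<close> along the tour, extended by the identity outside the vertex
  set so as to be a permutation of all naturals.\<close>

definition rot :: "nat \<Rightarrow> nat \<Rightarrow> nat" where
  "rot j v = (if v \<in> verts n then h ((inv_into {..<n} h v + j) mod n) else v)"

lemma rot_h: "i < n \<Longrightarrow> rot j (h i) = h ((i + j) mod n)"
  using bij h_verts by (simp add: rot_def bij_betw_def)

lemma mod_add_right_cancel:
  assumes "(a + j) mod n = (b + j) mod n" "a < n" "b < n" shows "a = b"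
  using assms
proof (induction a b rule: linorder_wlog)
  case (le a b)
  then have "n dvd (b + j) - (a + j)" by (metis add_le_mono1 mod_eq_dvd_iff_nat)
  then have "n dvd b - a" by simp
  then show ?case using le by (metis dvd_imp_le le_antisym less_imp_diff_less not_less zero_less_diff)
qed simp

lemma rot_relabelling: "relabelling n (rot j)"
proof
  have inj: "inj_on (rot j) (verts n)"
  proof (rule inj_onI)
    fix u v assume uv: "u \<in> verts n" "v \<in> verts n" "rot j u = rot j v"
    obtain a where a: "a < n" "u = h a" using h_surj uv(1) by blast
    obtain b where b: "b < n" "v = h b" using h_surj uv(2) by blast
    have "(a + j) mod n = (b + j) mod n" using uv(3) rot_h a b h_inj mod_lt by metis
    then show "u = v" using mod_add_right_cancel a b by blast
  qed
  have sub: "rot j ` verts n \<subseteq> verts n" using h_verts mod_lt by (auto simp: rot_def)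
  show eq: "rot j ` verts n = verts n"
    using endo_inj_surj[OF finite_verts sub inj] .
  have "bij_betw (rot j) (verts n) (verts n)" using inj eq by (simp add: bij_betw_def)
  moreover have "bij_betw (rot j) (- verts n) (- verts n)"
    by (rule bij_betw_cong[THEN iffD2, OF _ bij_betw_id]) (simp add: rot_def)
  ultimately have "bij_betw (rot j) (verts n \<union> - verts n) (verts n \<union> - verts n)"
    by (rule bij_betw_combine) simp
  then show "bij (rot j)" by simp
qed

lemma rot_H: "image (rot j) ` H = H"
proof -
  interpret relabelling n "rot j" by (rule rot_relabelling)
  have "relabel H \<subseteq> H"
  proof
    fix f assume "f \<in> relabel H"
    then obtain i where i: "i < n" "f = rot j ` {h i, h ((i + 1) mod n)}" using H_eq by blast
    have "(((i + 1) mod n) + j) mod n = (((i + j) mod n) + 1) mod n"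
      by (metis add.commute add.left_commute mod_add_left_eq)
    then have "f = {h ((i + j) mod n), h ((((i + j) mod n) + 1) mod n)}"
      using i rot_h[OF i(1)] rot_h[OF mod_lt] by simp
    then show "f \<in> H" using H_eq mod_lt by blast
  qed
  moreover have "card (relabel H) = card H"
    by (rule card_image[OF inj_on_subset[OF inj_image_edge subset_UNIV]])
  ultimately show ?thesis using finite_H by (simp add: card_subset_eq)
qed

abbreviation G :: "nat set set pmf" where "G \<equiv> generate n (PiH n H)"

lemma gen: "gen n (PiH n H)" by (rule gen_PiH[OF n3])

lemma map_G: "map_pmf (image (image (rot j))) G = G"
proof -
  interpret relabelling n "rot j" by (rule rot_relabelling)
  have "\<sigma> ` e \<in> H \<longleftrightarrow> e \<in> H" if "\<sigma> = rot j" for e \<sigma>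
    using image_in_relabel[of e H] rot_H[of j] that by simp
  then have "edge_weight (PiH n H) (rot j ` e) = edge_weight (PiH n H) e" if "e \<in> kn_edges n" for e
    using that kn_edges_image edge_weight_PiH by simp
  from map_gen_steps[OF gen this reach_empty[OF n3]] show ?thesis by (simp add: generate_def)
qed

lemma prob_differs_rot:
  "measure_pmf.prob G {X. (rot j ` e \<in> X) \<noteq> (rot j ` e \<in> H)} = measure_pmf.prob G {X. (e \<in> X) \<noteq> (e \<in> H)}"
proof -
  interpret relabelling n "rot j" by (rule rot_relabelling)
  have "rot j ` e \<in> H \<longleftrightarrow> e \<in> H" using image_in_relabel[of e H] rot_H[of j] by simp
  then have "{X. (e \<in> X) \<noteq> (e \<in> H)} = relabel -` {X. (rot j ` e \<in> X) \<noteq> (rot j ` e \<in> H)}"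
    using image_in_relabel by auto
  then have "measure_pmf.prob G {X. (e \<in> X) \<noteq> (e \<in> H)}
      = measure_pmf.prob (map_pmf relabel G) {X. (rot j ` e \<in> X) \<noteq> (rot j ` e \<in> H)}"
    by simp
  then show ?thesis by (simp only: map_G)
qed

text \<open>A fixed endpoint of \<open>e\<close> is sent to n different vertices by the n rotations,
  and the edges of \<open>D\<close> cover at most twice \<open>card D\<close> vertices.\<close>

lemma card_rotations_in:
  assumes e: "e \<in> kn_edges n" and D: "D \<subseteq> kn_edges n"
  shows "card {j. j < n \<and> rot j ` e \<in> D} \<le> 2 * card D"
proof -
  have finD: "finite D" using D finite_kn_edges finite_subset by blast
  have card_edge: "card f \<le> 2 \<and> finite f" if "f \<in> D" for f
    using that D by (auto simp: kn_edges_def card_insert_if)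
  obtain u where u: "u \<in> e" "u \<in> verts n" using e unfolding kn_edges_def by blast
  obtain a where a: "a < n" "u = h a" using h_surj u(2) by blast
  have "inj_on (\<lambda>j. rot j u) {j. j < n \<and> rot j ` e \<in> D}"
  proof (rule inj_onI)
    fix i j assume ij: "i \<in> {j. j < n \<and> rot j ` e \<in> D}" "j \<in> {j. j < n \<and> rot j ` e \<in> D}"
      "rot i u = rot j u"
    have "(a + i) mod n = (a + j) mod n" using ij(3) rot_h a h_inj mod_lt by metis
    then have "(i + a) mod n = (j + a) mod n" by (simp only: add.commute)
    then show "i = j" using mod_add_right_cancel ij by blast
  qed
  moreover have "(\<lambda>j. rot j u) ` {j. j < n \<and> rot j ` e \<in> D} \<subseteq> \<Union>D" using u by auto
  moreover have "finite (\<Union>D)" using finD card_edge by auto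
  ultimately have "card {j. j < n \<and> rot j ` e \<in> D} \<le> card (\<Union>D)" by (rule card_inj_on_le)
  also have "\<dots> \<le> (\<Sum>f\<in>D. card f)" using finD by (rule_tac card_Union_le_sum_card)
  also have "\<dots> \<le> (\<Sum>f\<in>D. 2)" using card_edge by (intro sum_mono) auto
  finally show ?thesis by simp
qed

text \<open>By rotational symmetry an edge is affected with the average probability over its orbit.\<close>
lemma prob_differs:
  assumes e: "e \<in> kn_edges n"
  shows "real n * measure_pmf.prob G {X. (e \<in> X) \<noteq> (e \<in> H)}
    \<le> 4 * measure_pmf.expectation G (\<lambda>X. real (card (X - H)))"
proof -
  interpret g: gen n "PiH n H" by (rule gen)
  note int = integrable_measure_pmf_finite[OF g.finite_set_generate]
  let ?c = "\<lambda>X. card {j. j < n \<and> (rot j ` e \<in> X) \<noteq> (rot j ` e \<in> H)}"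
  have "real n * measure_pmf.prob G {X. (e \<in> X) \<noteq> (e \<in> H)}
      = (\<Sum>j<n. measure_pmf.prob G {X. (rot j ` e \<in> X) \<noteq> (rot j ` e \<in> H)})"
    unfolding prob_differs_rot by (simp del: not_iff)
  also have "\<dots> = (\<Sum>j<n. measure_pmf.expectation G
      (indicator {X. (rot j ` e \<in> X) \<noteq> (rot j ` e \<in> H)}))" by simp
  also have "\<dots> = measure_pmf.expectation G
      (\<lambda>X. \<Sum>j<n. indicator {X. (rot j ` e \<in> X) \<noteq> (rot j ` e \<in> H)} X)"
    by (rule Bochner_Integration.integral_sum[symmetric]) (rule int)
  also have "(\<lambda>X. \<Sum>j<n. indicator {X. (rot j ` e \<in> X) \<noteq> (rot j ` e \<in> H)} X) = (\<lambda>X. real (?c X))"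
  proof
    fix X
    have "(\<Sum>j<n. indicator {X. (rot j ` e \<in> X) \<noteq> (rot j ` e \<in> H)} X :: real)
        = (\<Sum>j<n. if (rot j ` e \<in> X) \<noteq> (rot j ` e \<in> H) then 1 else 0)"
      by (intro sum.cong) (auto simp: indicator_def)
    also have "\<dots> = real (card ({..<n} \<inter> {j. (rot j ` e \<in> X) \<noteq> (rot j ` e \<in> H)}))"
      by (simp add: sum.If_cases)
    also have "{..<n} \<inter> {j. (rot j ` e \<in> X) \<noteq> (rot j ` e \<in> H)}
        = {j. j < n \<and> (rot j ` e \<in> X) \<noteq> (rot j ` e \<in> H)}" by auto
    finally show "(\<Sum>j<n. indicator {X. (rot j ` e \<in> X) \<noteq> (rot j ` e \<in> H)} X) = real (?c X)" .
  qed
  also have "measure_pmf.expectation G (\<lambda>X. real (?c X))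
      \<le> measure_pmf.expectation G (\<lambda>X. 4 * real (card (X - H)))"
  proof (rule integral_mono_AE[OF int int])
    show "AE X in measure_pmf G. real (?c X) \<le> 4 * real (card (X - H))"
    proof (rule AE_pmfI)
      fix X assume "X \<in> set_pmf G"
      then have "ham_cycle n X" by (rule g.set_generate)
      then have X: "card X = n" "finite X" "X \<subseteq> kn_edges n" using ham_cycle_facts n3 by auto
      \<comment> \<open>Tours have equally many edges, so the symmetric difference has size 2
        \<open>card (X - H)\<close>; together with the 2 of \<open>card_rotations_in\<close> this
        yields the factor 4.\<close>
      have "card (H - X) = card (X - H)"
        using X finite_H card_H by (metis card_le_sym_Diff le_antisym order_refl)
      then have "card ((X - H) \<union> (H - X)) = 2 * card (X - H)"
        using X finite_H by (subst card_Un_disjoint) auto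
      moreover have "?c X \<le> 2 * card ((X - H) \<union> (H - X))"
      proof -
        have "{j. j < n \<and> (rot j ` e \<in> X) \<noteq> (rot j ` e \<in> H)}
            = {j. j < n \<and> rot j ` e \<in> (X - H) \<union> (H - X)}" by auto
        then show ?thesis using card_rotations_in[OF e, of "(X - H) \<union> (H - X)"] X(3) H_subset by auto
      qed
      ultimately show "real (?c X) \<le> 4 * real (card (X - H))" by linarith
    qed
  qed
  finally show ?thesis by simp
qed

text \<open>Truncation: the count is at most 9L outside the rare event of
  \<open>generate_far_from_ham\<close>, and never exceeds n.\<close>

lemma expected_new_edges:
  assumes n: "6 \<le> n"
  shows "measure_pmf.expectation G (\<lambda>X. real (card (X - H))) \<le> 9 * real L + real n * (exp 5 / 2 ^ L)"
proof -
  interpret g: gen n "PiH n H" by (rule gen)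
  note int = integrable_measure_pmf_finite[OF g.finite_set_generate]
  let ?E = "{X. 9 * L < card (X - H)}"
  have "measure_pmf.expectation G (\<lambda>X. real (card (X - H)))
      \<le> measure_pmf.expectation G (\<lambda>X. 9 * real L + real n * indicator ?E X)"
  proof (rule integral_mono_AE[OF int int], rule AE_pmfI)
    fix X assume "X \<in> set_pmf G"
    then have "ham_cycle n X" by (rule g.set_generate)
    then have "card (X - H) \<le> n" using ham_cycle_facts n3 by (metis card_Diff_subset_Int card_mono Diff_subset)
    then show "real (card (X - H)) \<le> 9 * real L + real n * indicator ?E X"
      by (cases "X \<in> ?E") auto
  qed
  also have "\<dots> = 9 * real L + real n * measure_pmf.prob G ?E"
    by (subst Bochner_Integration.integral_add) (auto intro!: int)
  also have "\<dots> \<le> 9 * real L + real n * (exp 5 / 2 ^ L)"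
    using generate_far_from_ham[OF n ham_cycle] by (intro add_left_mono mult_left_mono) auto
  finally show ?thesis .
qed

end

section \<open>Drift of the potential\<close>

lemma ham_s_star: assumes "3 \<le> n" shows "ham_cycle n (s_star n)"
  unfolding ham_cycle_def
proof (intro exI conjI)
  show "bij_betw Suc {..<n} (verts n)"
    unfolding bij_betw_def verts_def by (simp add: lessThan_atLeast0 image_Suc_atLeastLessThan atLeastLessThanSuc_atLeastAtMost)
  show "s_star n = {{Suc i, Suc ((i + 1) mod n)} | i. i < n}" (is "_ = ?R")
  proof
    show "s_star n \<subseteq> ?R"
    proof
      fix e assume "e \<in> s_star n"
      then consider i where "1 \<le> i" "i < n" "e = {i, i + 1}" | "e = {n, 1}"
        unfolding s_star_def by auto
      then show "e \<in> ?R"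
      proof cases
        case (1 i)
        then have "e = {Suc (i - 1), Suc ((i - 1 + 1) mod n)}" "i - 1 < n" by auto
        then show ?thesis by blast
      next
        case 2
        then have "e = {Suc (n - 1), Suc ((n - 1 + 1) mod n)}" "n - 1 < n" using assms by auto
        then show ?thesis by blast
      qed
    qed
    show "?R \<subseteq> s_star n"
    proof
      fix e assume "e \<in> ?R"
      then obtain i where i: "i < n" "e = {Suc i, Suc ((i + 1) mod n)}" by blast
      show "e \<in> s_star n"
      proof (cases "i + 1 = n")
        case True
        then have "e = {n, 1}" using i by auto
        then show ?thesis unfolding s_star_def by simp
      next
        case False
        then have "e = {Suc i, Suc i + 1}" "1 \<le> Suc i" "Suc i < n" using i by auto
        then show ?thesis unfolding s_star_def by blast
      qed
    qed
  qed
qed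

definition missing :: "nat \<Rightarrow> nat set set \<Rightarrow> nat" where
  "missing n X = card (s_star n - X)"

lemma missing_eq:
  assumes "ham_cycle n X" "3 \<le> n"
  shows "card (X - s_star n) = missing n X" "card (X \<inter> s_star n) + missing n X = n"
proof -
  note X = ham_cycle_facts[OF assms] and s = ham_cycle_facts[OF ham_s_star[OF assms(2)] assms(2)]
  have a: "card (X - s_star n) + card (X \<inter> s_star n) = n"
    using card_Diff_subset_Int[of X "s_star n"] X card_mono[of X "X \<inter> s_star n"] by simp
  have b: "card (s_star n - X) + card (X \<inter> s_star n) = n"
    using card_Diff_subset_Int[of "s_star n" X] s card_mono[of "s_star n" "X \<inter> s_star n"]
    by (simp add: Int_commute)
  show "card (X - s_star n) = missing n X" "card (X \<inter> s_star n) + missing n X = n"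
    using a b by (simp_all add: missing_def)
qed

section \<open>Independent samples and the iteration best\<close>

lemma best_in_set: assumes "xs \<noteq> []" shows "best d xs \<in> set xs"
proof -
  let ?f = "filter (\<lambda>x. cost d x = Min (cost d ` set xs)) xs"
  have "Min (cost d ` set xs) \<in> cost d ` set xs" using assms by (intro Min_in) auto
  then have "?f \<noteq> []" by (auto simp: filter_empty_conv)
  then have "best d xs \<in> set ?f" unfolding best_def by (rule hd_in_set)
  then show ?thesis by auto
qed

lemma samples_Suc: "samples (Suc N) p = bind_pmf p (\<lambda>x. map_pmf (Cons x) (samples N p))"
  by (simp add: map_pmf_def)

lemma set_samples: "xs \<in> set_pmf (samples N p) \<Longrightarrow> length xs = N \<and> set xs \<subseteq> set_pmf p"
  by (induction N arbitrary: xs) fastforce+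

lemma finite_set_samples: "finite (set_pmf p) \<Longrightarrow> finite (set_pmf (samples N p))"
  by (induction N) auto

lemma prob_samples_all:
  "measure_pmf.prob (samples N p) {xs. set xs \<subseteq> A} = measure_pmf.prob p A ^ N"
proof (induction N)
  case (Suc N)
  have "measure_pmf.prob (samples (Suc N) p) {xs. set xs \<subseteq> A}
      = measure_pmf.expectation p (\<lambda>x. measure_pmf.prob p A ^ N * indicator A x)"
    unfolding samples_Suc prob_bind_pmf
  proof (rule Bochner_Integration.integral_cong[OF refl])
    fix x
    have "Cons x -` {xs. set xs \<subseteq> A} = (if x \<in> A then {xs. set xs \<subseteq> A} else {})" by auto
    then show "measure_pmf.prob (map_pmf (Cons x) (samples N p)) {xs. set xs \<subseteq> A}
        = measure_pmf.prob p A ^ N * indicator A x"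
      using Suc by simp
  qed
  then show ?case by simp
qed simp

text \<open>Union bound over the samples, obtained from the complementary event and Bernoulli's
  inequality.\<close>

lemma prob_samples_some:
  "measure_pmf.prob (samples N p) {xs. \<exists>x\<in>set xs. x \<in> A} \<le> real N * measure_pmf.prob p A"
proof -
  have "{xs. \<exists>x\<in>set xs. x \<in> A} = UNIV - {xs. set xs \<subseteq> - A}" by auto
  then have "measure_pmf.prob (samples N p) {xs. \<exists>x\<in>set xs. x \<in> A} = 1 - measure_pmf.prob p (- A) ^ N"
    using measure_pmf.prob_compl[of "{xs. set xs \<subseteq> - A}" "samples N p"] by (simp add: prob_samples_all)
  also have "measure_pmf.prob p (- A) = 1 + - measure_pmf.prob p A"
    using measure_pmf.prob_compl[of A p] by (simp add: Compl_eq_Diff_UNIV)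
  also have "1 - (1 + - measure_pmf.prob p A) ^ N \<le> real N * measure_pmf.prob p A"
    using Bernoulli_inequality[of "- measure_pmf.prob p A" N] by simp
  finally show ?thesis .
qed

definition potential :: "real \<Rightarrow> nat \<Rightarrow> nat set set \<Rightarrow> real" where
  "potential l n X = exp (- l * real (missing n X))"

lemma potential_s_star: "potential l n (s_star n) = 1"
  by (simp add: potential_def missing_def)

lemma potential_nonneg: "0 \<le> potential l n X"
  by (simp add: potential_def)

lemma potential_mono: "0 \<le> l \<Longrightarrow> k \<le> real (missing n X) \<Longrightarrow> potential l n X \<le> exp (- l * k)"
  by (simp add: potential_def mult_left_mono)

lemma potential_le_1: "0 \<le> l \<Longrightarrow> potential l n X \<le> 1"
  using potential_mono[of l 0 n X] by simp

context gen begin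

lemma finite_set_iter: "finite (set_pmf (samples N (generate n P)))"
  by (rule finite_set_samples[OF finite_set_generate])

lemma set_iter_best:
  assumes "1 \<le> N" "X \<in> set_pmf (iter_best n N d P)"
  shows "ham_cycle n X"
proof -
  obtain xs where xs: "xs \<in> set_pmf (samples N (generate n P))" "X = best d xs"
    using assms(2) unfolding iter_best_def by auto
  then have "length xs = N" "set xs \<subseteq> set_pmf (generate n P)" using set_samples by auto
  moreover from this have "xs \<noteq> []" using assms(1) by auto
  ultimately show ?thesis using best_in_set[of xs d] xs set_generate by auto
qed

text \<open>The iteration best is one of the samples, so events quantified over all samples bound it
  whichever one is selected: \<open>A\<close> collects the good samples, all of which must be good
  to secure the decrease \<open>b\<close>; \<open>C\<close> and \<open>D\<close> collect bad ones,
  charged with \<open>c\<close>, and with 1, the maximum of the potential.\<close>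

lemma expectation_iter_best_le:
  assumes "1 \<le> N"
    and f: "\<And>xs. xs \<noteq> [] \<Longrightarrow> length xs = N \<Longrightarrow> set xs \<subseteq> set_pmf (generate n P) \<Longrightarrow>
      f (best d xs) \<le> a - b * indicator {xs. set xs \<subseteq> A} xs
        + c * indicator {xs. \<exists>x\<in>set xs. x \<in> C} xs + indicator {xs. \<exists>x\<in>set xs. x \<in> D} xs"
    and "0 \<le> c"
  shows "measure_pmf.expectation (iter_best n N d P) f
    \<le> a - b * measure_pmf.prob (generate n P) A ^ N
      + c * (real N * measure_pmf.prob (generate n P) C) + real N * measure_pmf.prob (generate n P) D"
proof -
  note int = integrable_measure_pmf_finite[OF finite_set_iter]
  let ?S = "samples N (generate n P)"
  have "measure_pmf.expectation (iter_best n N d P) f = measure_pmf.expectation ?S (\<lambda>xs. f (best d xs))"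
    unfolding iter_best_def by simp
  also have "\<dots> \<le> measure_pmf.expectation ?S (\<lambda>xs. a - b * indicator {xs. set xs \<subseteq> A} xs
        + c * indicator {xs. \<exists>x\<in>set xs. x \<in> C} xs + indicator {xs. \<exists>x\<in>set xs. x \<in> D} xs)"
  proof (rule integral_mono_AE[OF int int], rule AE_pmfI, rule f)
    fix xs assume "xs \<in> set_pmf ?S"
    then show "length xs = N" "set xs \<subseteq> set_pmf (generate n P)" using set_samples by auto
    then show "xs \<noteq> []" using assms(1) by auto
  qed
  also have "\<dots> = a - b * measure_pmf.prob ?S {xs. set xs \<subseteq> A}
        + c * measure_pmf.prob ?S {xs. \<exists>x\<in>set xs. x \<in> C} + measure_pmf.prob ?S {xs. \<exists>x\<in>set xs. x \<in> D}"
    by (simp add: int Bochner_Integration.integral_add Bochner_Integration.integral_diff)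
  also have "\<dots> \<le> a - b * measure_pmf.prob (generate n P) A ^ N
      + c * (real N * measure_pmf.prob (generate n P) C) + real N * measure_pmf.prob (generate n P) D"
    using prob_samples_some[of N "generate n P"] \<open>0 \<le> c\<close>
    by (intro add_mono mult_left_mono) (auto simp: prob_samples_all)
  finally show ?thesis .
qed

end

text \<open>Either the best tour misses at least \<open>K\<close> edges, giving the first term, or
  some sample shares n - K edges with \<open>s_star n\<close> and the potential is bounded by
  1.\<close>

lemma initial_potential:
  assumes n: "10 \<le> n" and N: "1 \<le> N" and l: "0 \<le> l"
  shows "measure_pmf.expectation (iter_best n N d (Pi0 n)) (potential l n)
    \<le> exp (- l * real K) + real N * (exp 9 / 2 ^ (n - K - n div 2))"
proof -
  have n3: "3 \<le> n" using n by simp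
  interpret gen n "Pi0 n" by (rule gen_Pi0[OF n3])
  let ?D = "{X. n - K \<le> card (X \<inter> s_star n)}"
  have "measure_pmf.expectation (iter_best n N d (Pi0 n)) (potential l n)
    \<le> exp (- l * real K) - 0 * measure_pmf.prob (generate n (Pi0 n)) {} ^ N
      + 0 * (real N * measure_pmf.prob (generate n (Pi0 n)) {})
      + real N * measure_pmf.prob (generate n (Pi0 n)) ?D"
  proof (rule expectation_iter_best_le[OF N])
    fix xs assume xs: "xs \<noteq> []" "set xs \<subseteq> set_pmf (generate n (Pi0 n))"
    let ?b = "best d xs"
    have b: "?b \<in> set xs" using best_in_set[OF xs(1)] .
    then have ham: "ham_cycle n ?b" using xs set_generate by auto
    show "potential l n ?b \<le> exp (- l * real K) - 0 * indicator {xs. set xs \<subseteq> {}} xs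
      + 0 * indicator {xs. \<exists>x\<in>set xs. x \<in> {}} xs + indicator {xs. \<exists>x\<in>set xs. x \<in> ?D} xs"
    proof (cases "?b \<in> ?D")
      case True
      then have "indicator {xs. \<exists>x\<in>set xs. x \<in> ?D} xs = (1::real)" using b by (auto simp: indicator_def)
      then show ?thesis using potential_le_1[OF l, of n ?b] by (simp add: add_increasing)
    next
      case False
      then have "real K \<le> real (missing n ?b)" using missing_eq(2)[OF ham n3] by simp
      then have "potential l n ?b \<le> exp (- l * real K)" by (rule potential_mono[OF l])
      then show ?thesis by (simp add: indicator_def)
    qed
  qed simp
  also have "\<dots> \<le> exp (- l * real K) + real N * (exp 9 / 2 ^ (n - K - n div 2))"
    using generate_Pi0_overlap[OF n, of "s_star n" K] ham_cycle_facts[OF ham_s_star[OF n3] n3]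
    by (auto intro!: mult_left_mono simp del: times_divide_eq_right)
  finally show ?thesis .
qed

section \<open>One iteration started at a fixed tour\<close>

context ham begin

definition touched :: "nat set set set" where
  "touched = {X. \<exists>e\<in>(s_star n - H) \<union> (H - s_star n). (e \<in> X) \<noteq> (e \<in> H)}"

text \<open>An edge of \<open>s_star n\<close> that is absent from \<open>H\<close> but present in X
  is foreign to \<open>H\<close>, so each recovered edge costs one new edge.\<close>

lemma missing_le: "ham_cycle n X \<Longrightarrow> missing n H \<le> missing n X + card (X - H)"
proof -
  assume "ham_cycle n X"
  then have X: "finite X" using ham_cycle_facts n3 by blast
  have fs: "finite (s_star n)" using ham_cycle_facts ham_s_star n3 by blast
  have "card (s_star n - H) \<le> card ((s_star n - X) \<union> (X - H))" using X fs by (intro card_mono) auto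
  also have "\<dots> \<le> card (s_star n - X) + card (X - H)" by (rule card_Un_le)
  finally show ?thesis by (simp add: missing_def)
qed

text \<open>Both halves of the symmetric difference matter. Agreement on \<open>s_star n - H\<close>
  means that no missing edge is recovered. Since X differs from \<open>H\<close> and has the same
  size, it drops some edge of \<open>H\<close>, and agreement on \<open>H - s_star n\<close> forces
  that edge into \<open>s_star n\<close>.\<close>

lemma missing_untouched:
  assumes X: "ham_cycle n X" "X \<notin> touched" "X \<noteq> H"
  shows "missing n H + 1 \<le> missing n X"
proof -
  have fs: "finite (s_star n)" using ham_cycle_facts ham_s_star n3 by blast
  have "\<not> H \<subseteq> X"
    using X ham_cycle_facts[OF X(1) n3] card_H by (metis card_subset_eq)
  then obtain e where e: "e \<in> H" "e \<notin> X" by auto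
  have agree: "(f \<in> X) = (f \<in> H)" if "f \<in> (s_star n - H) \<union> (H - s_star n)" for f
    using X(2) that unfolding touched_def by blast
  have "e \<in> s_star n" using agree[of e] e by auto
  moreover have "s_star n - H \<subseteq> s_star n - X" using agree by auto
  ultimately have "insert e (s_star n - H) \<subseteq> s_star n - X" using e by auto
  then have "card (insert e (s_star n - H)) \<le> card (s_star n - X)" using fs by (intro card_mono) auto
  then show ?thesis using e fs by (simp add: missing_def)
qed

text \<open>Union bound over the 2 \<open>missing n H\<close> edges of the symmetric difference,
  each affected with probability at most 4/n times the expected number of new edges.\<close>

lemma prob_touched:
  assumes n: "6 \<le> n"
  shows "measure_pmf.prob G touched \<le> 8 * real (missing n H) * (9 * real L + real n * (exp 5 / 2 ^ L)) / real n"
proof -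
  let ?Z = "(s_star n - H) \<union> (H - s_star n)"
  let ?E = "9 * real L + real n * (exp 5 / 2 ^ L)"
  have s: "finite (s_star n)" "s_star n \<subseteq> kn_edges n"
    using ham_cycle_facts[OF ham_s_star[OF n3] n3] by auto
  have Z: "?Z \<subseteq> kn_edges n" "finite ?Z" using s H_subset finite_H by auto
  have cZ: "card ?Z = 2 * missing n H"
    using missing_eq(1)[OF ham_cycle n3] s finite_H
    by (subst card_Un_disjoint) (auto simp: missing_def)
  have single: "measure_pmf.prob G {X. (e \<in> X) \<noteq> (e \<in> H)} \<le> 4 * ?E / real n" if "e \<in> ?Z" for e
  proof -
    have "real n * measure_pmf.prob G {X. (e \<in> X) \<noteq> (e \<in> H)} \<le> 4 * ?E"
      using prob_differs[of e] expected_new_edges[OF n, of L] that Z by fastforce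
    then show ?thesis using n by (simp add: field_simps)
  qed
  have "touched = (\<Union>e\<in>?Z. {X. (e \<in> X) \<noteq> (e \<in> H)})" unfolding touched_def by auto
  then have "measure_pmf.prob G touched \<le> (\<Sum>e\<in>?Z. measure_pmf.prob G {X. (e \<in> X) \<noteq> (e \<in> H)})"
    using measure_pmf.finite_measure_subadditive_finite[OF Z(2), of "\<lambda>e. {X. (e \<in> X) \<noteq> (e \<in> H)}" G] by simp
  also have "\<dots> \<le> (\<Sum>e\<in>?Z. 4 * ?E / real n)" using single by (rule sum_mono)
  also have "\<dots> = 8 * real (missing n H) * ?E / real n" by (simp add: cZ)
  finally show ?thesis .
qed

text \<open>\<tau> bounds the probability of a touched sample when at most \<open>K\<close> edges
  are missing. The last hypothesis says that the expected increase through touched samples, by a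
  factor of at most e, is outweighed by the expected decrease when all N samples lose an edge. The
  error collects tours with more than \<open>K\<close> missing edges and samples far from
  \<open>H\<close>.\<close>

lemma drift:
  assumes n: "100 \<le> n" and N: "1 \<le> N" and L: "1 \<le> L"
    and l: "l = 1 / (9 * real L)"
    and \<tau>: "\<tau> = 8 * real K * (9 * real L + real n * (exp 5 / 2 ^ L)) / real n"
    and \<tau>1: "\<tau> \<le> 1 / 33"
    and \<tau>2: "exp 1 * (real N * \<tau>) \<le> (1 / 33 - \<tau>) ^ N * (1 - exp (- l))"
  shows "measure_pmf.expectation (iter_best n N d (PiH n H)) (potential l n)
    \<le> potential l n H + (exp (- l * (real K - 9 * real L)) + real N * (exp 5 / 2 ^ L))"
proof -
  interpret g: gen n "PiH n H" by (rule gen)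
  have l0: "0 < l" using l L by simp
  have n6: "6 \<le> n" using n by simp
  let ?D = "{X. 9 * L < card (X - H)}"
  let ?\<phi> = "potential l n"
  have D: "measure_pmf.prob G ?D \<le> exp 5 / 2 ^ L" by (rule generate_far_from_ham[OF n6 ham_cycle])
  show ?thesis
  proof (cases "missing n H \<le> K")
    case False
    \<comment> \<open>With more than \<open>K\<close> edges missing, a sample within 9L new edges
      still misses at least K - 9L, so no use of the current potential is made.\<close>
    let ?a = "exp (- l * (real K - 9 * real L))"
    have "measure_pmf.expectation (iter_best n N d (PiH n H)) ?\<phi>
      \<le> ?a - 0 * measure_pmf.prob G {} ^ N + 0 * (real N * measure_pmf.prob G {})
        + real N * measure_pmf.prob G ?D"
    proof (rule g.expectation_iter_best_le[OF N])
      fix xs assume xs: "xs \<noteq> []" "set xs \<subseteq> set_pmf G"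
      let ?b = "best d xs"
      have b: "?b \<in> set xs" using best_in_set[OF xs(1)] .
      then have hb: "ham_cycle n ?b" using xs g.set_generate by auto
      show "?\<phi> ?b \<le> ?a - 0 * indicator {xs. set xs \<subseteq> {}} xs
        + 0 * indicator {xs. \<exists>x\<in>set xs. x \<in> {}} xs + indicator {xs. \<exists>x\<in>set xs. x \<in> ?D} xs"
      proof (cases "?b \<in> ?D")
        case True
        then have "indicator {xs. \<exists>x\<in>set xs. x \<in> ?D} xs = (1::real)" using b by (auto simp: indicator_def)
        then show ?thesis using potential_le_1[of l n ?b] l0 by (simp add: add_increasing)
      next
        case bD: False
        then have "missing n H \<le> missing n ?b + 9 * L" using missing_le[OF hb] by simp
        then have "real K - 9 * real L \<le> real (missing n ?b)" using False by linarith
        then have "?\<phi> ?b \<le> ?a" using l0 by (intro potential_mono) auto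
        then show ?thesis by (simp add: indicator_def)
      qed
    qed simp
    also have "\<dots> \<le> ?a + real N * (exp 5 / 2 ^ L)"
      using D by (auto intro!: mult_left_mono simp del: times_divide_eq_right)
    finally show ?thesis using potential_nonneg[of l n H] by linarith
  next
    case True
    have E0: "0 \<le> 9 * real L + real n * (exp 5 / 2 ^ L)" by simp
    have "measure_pmf.prob G touched \<le> 8 * real (missing n H) * (9 * real L + real n * (exp 5 / 2 ^ L)) / real n"
      by (rule prob_touched[OF n6])
    also have "\<dots> \<le> \<tau>" unfolding \<tau> using True E0 by (intro divide_right_mono mult_right_mono) auto
    finally have T: "measure_pmf.prob G touched \<le> \<tau>" .
    \<comment> \<open>Samples that are untouched and differ from \<open>H\<close>, that is, those
      certain to have lost an edge of \<open>s_star n\<close>.\<close>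
    let ?A = "- (touched \<union> {H})"
    have "measure_pmf.prob G (touched \<union> {H}) \<le> measure_pmf.prob G touched + measure_pmf.prob G {H}"
      by (rule measure_Un_le) auto
    also have "\<dots> \<le> \<tau> + 32 / 33" using T generate_same_ham[OF n ham_cycle] by simp
    finally have "1 / 33 - \<tau> \<le> measure_pmf.prob G ?A"
      using measure_pmf.prob_compl[of "touched \<union> {H}" G] by (simp add: Compl_eq_Diff_UNIV)
    then have A: "(1 / 33 - \<tau>) ^ N \<le> measure_pmf.prob G ?A ^ N" using \<tau>1 by (intro power_mono) auto
    let ?b = "?\<phi> H * (1 - exp (- l))" and ?c = "?\<phi> H * exp 1"
    have e1: "0 \<le> 1 - exp (- l)" using l0 by simp
    have "measure_pmf.expectation (iter_best n N d (PiH n H)) ?\<phi>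
      \<le> ?\<phi> H - ?b * measure_pmf.prob G ?A ^ N + ?c * (real N * measure_pmf.prob G touched)
        + real N * measure_pmf.prob G ?D"
    proof (rule g.expectation_iter_best_le[OF N])
      fix xs assume xs: "xs \<noteq> []" "set xs \<subseteq> set_pmf G"
      let ?x = "best d xs"
      let ?IA = "indicator {xs. set xs \<subseteq> ?A} xs :: real"
      let ?IC = "indicator {xs. \<exists>x\<in>set xs. x \<in> touched} xs :: real"
      let ?ID = "indicator {xs. \<exists>x\<in>set xs. x \<in> ?D} xs :: real"
      have x: "?x \<in> set xs" using best_in_set[OF xs(1)] .
      then have hx: "ham_cycle n ?x" using xs g.set_generate by auto
      have p0: "0 \<le> ?\<phi> H" by (rule potential_nonneg)
      have b0: "0 \<le> ?b" "?b \<le> ?\<phi> H" using p0 e1 by (auto simp: mult_left_le)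
      have I: "0 \<le> ?IA" "?IA \<le> 1" "0 \<le> ?IC" "0 \<le> ?ID" by (auto simp: indicator_def)
      have c0: "0 \<le> ?c * ?IC" using p0 I by simp
      have bA: "?b * ?IA \<le> ?b" using b0 I by (simp add: mult_left_le)
      show "?\<phi> ?x \<le> ?\<phi> H - ?b * ?IA + ?c * ?IC + ?ID"
      proof (cases "?x \<in> ?D")
        case True
        then have "?ID = 1" using x by (auto simp: indicator_def)
        moreover have "?\<phi> ?x \<le> 1" using potential_le_1[of l n ?x] l0 by simp
        ultimately show ?thesis using bA b0 c0 by linarith
      next
        case nD: False
        show ?thesis
        proof (cases "?x \<in> touched")
          case True
          then have "?IC = 1" "?IA = 0" using x by (auto simp: indicator_def)
          have "missing n H \<le> missing n ?x + 9 * L" using missing_le[OF hx] nD by simp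
          then have "real (missing n H) - 9 * real L \<le> real (missing n ?x)" by linarith
          then have "?\<phi> ?x \<le> exp (- l * (real (missing n H) - 9 * real L))"
            using l0 by (intro potential_mono) auto
          \<comment> \<open>Because l * 9L = 1, a jump of 9L edges costs exactly the factor
            e.\<close>
          also have "\<dots> = ?c"
            using L by (simp add: potential_def l exp_add[symmetric] field_simps)
          finally have "?\<phi> ?x \<le> ?c * ?IC" using \<open>?IC = 1\<close> by simp
          moreover have "?b * ?IA = 0" using \<open>?IA = 0\<close> by simp
          ultimately show ?thesis using p0 I by linarith
        next
          case nT: False
          show ?thesis
          proof (cases "?x = H")
            case True
            then have "?IA = 0" using x by (auto simp: indicator_def)
            then show ?thesis using True c0 I by simp
          next
            case False
            have "missing n H + 1 \<le> missing n ?x" by (rule missing_untouched[OF hx nT False])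
            then have "real (missing n H) + 1 \<le> real (missing n ?x)" by linarith
            then have "?\<phi> ?x \<le> exp (- l * (real (missing n H) + 1))"
              using l0 by (intro potential_mono) auto
            also have "\<dots> = ?\<phi> H - ?b"
              by (simp add: potential_def exp_add[symmetric] algebra_simps)
            finally show ?thesis using bA c0 I by linarith
          qed
        qed
      qed
    qed (simp add: potential_nonneg)
    also have "\<dots> \<le> ?\<phi> H - ?b * (1 / 33 - \<tau>) ^ N + ?c * (real N * \<tau>) + real N * (exp 5 / 2 ^ L)"
      using A T D e1 potential_nonneg[of l n H]
      by (intro add_mono diff_mono mult_left_mono) auto
    also have "\<dots> = ?\<phi> H + ?\<phi> H * (exp 1 * (real N * \<tau>) - (1 / 33 - \<tau>) ^ N * (1 - exp (- l)))
        + real N * (exp 5 / 2 ^ L)" by (simp add: algebra_simps)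
    also have "\<dots> \<le> ?\<phi> H + real N * (exp 5 / 2 ^ L)"
      using \<tau>2 potential_nonneg[of l n H] by (simp add: mult_nonneg_nonpos)
    also have "\<dots> \<le> ?\<phi> H + (exp (- l * (real K - 9 * real L)) + real N * (exp 5 / 2 ^ L))" by simp
    finally show ?thesis .
  qed
qed

end

text \<open>The potential is nonnegative and equals 1 at \<open>s_star n\<close>, so it dominates
  the indicator of success, and each further iteration adds at most \<delta>: a maximal inequality
  proved by induction on \<open>T\<close>. The matrix is generalised because the first one,
  \<open>Pi0 n\<close>, does not come from a tour.\<close>

lemma found_from_le:
  assumes n: "3 \<le> n" and N: "1 \<le> N" and l: "0 \<le> l" and d0: "0 \<le> \<delta>" and P: "gen n P"
    and drift: "\<And>H. ham_cycle n H \<Longrightarrow>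
      measure_pmf.expectation (iter_best n N d (PiH n H)) (potential l n) \<le> potential l n H + \<delta>"
  shows "pmf (found_from n N d (s_star n) T P) True
    \<le> measure_pmf.expectation (iter_best n N d P) (potential l n) + real T * \<delta>"
  using P
proof (induction T arbitrary: P)
  case (0 P)
  interpret gen n P by fact
  have fin: "finite (set_pmf (iter_best n N d P))" unfolding iter_best_def using finite_set_iter by simp
  note int = integrable_measure_pmf_finite[OF fin]
  have "pmf (found_from n N d (s_star n) 0 P) True = measure_pmf.prob (iter_best n N d P) {s_star n}"
    by (simp add: pmf_map vimage_def)
  also have "\<dots> = measure_pmf.expectation (iter_best n N d P) (indicator {s_star n})" by simp
  also have "\<dots> \<le> measure_pmf.expectation (iter_best n N d P) (potential l n)"
    by (rule integral_mono_AE[OF int int]) (auto simp: indicator_def potential_s_star potential_nonneg)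
  finally show ?case by simp
next
  case (Suc T P)
  interpret gen n P by fact
  have fin: "finite (set_pmf (iter_best n N d P))" unfolding iter_best_def using finite_set_iter by simp
  note int = integrable_measure_pmf_finite[OF fin]
  have "pmf (found_from n N d (s_star n) (Suc T) P) True = measure_pmf.expectation (iter_best n N d P)
      (\<lambda>X. pmf (if X = s_star n then return_pmf True else found_from n N d (s_star n) T (PiH n X)) True)"
    by (simp add: pmf_bind)
  also have "\<dots> \<le> measure_pmf.expectation (iter_best n N d P) (\<lambda>X. potential l n X + real (Suc T) * \<delta>)"
  proof (rule integral_mono_AE[OF int int], rule AE_pmfI)
    fix X assume "X \<in> set_pmf (iter_best n N d P)"
    then have X: "ham_cycle n X" using set_iter_best[OF N] by blast
    show "pmf (if X = s_star n then return_pmf True else found_from n N d (s_star n) T (PiH n X)) True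
        \<le> potential l n X + real (Suc T) * \<delta>"
    proof (cases "X = s_star n")
      case True
      then show ?thesis using d0 by (simp add: potential_s_star)
    next
      case False
      then show ?thesis using Suc.IH[OF gen_PiH[OF n], of X] drift[OF X] by (simp add: algebra_simps)
    qed
  qed
  also have "\<dots> = measure_pmf.expectation (iter_best n N d P) (potential l n) + real (Suc T) * \<delta>"
    by (simp add: int Bochner_Integration.integral_add)
  finally show ?case .
qed

section \<open>Choice of the parameters\<close>

text \<open>With \<open>L\<close> between \<open>x n\<close> and \<open>2 * x n\<close>, \<open>54 * x n ^ 2\<close> bounds \<open>K = 9 * L + 9 * L\<^sup>2\<close>, and
  \<open>8208 = 8 * 54 * 19\<close> arises from the bound \<open>ham.prob_touched\<close>.\<close>
lemma asymptotic_bounds: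
  fixes x :: "real \<Rightarrow> real"
  defines "x \<equiv> \<lambda>n. n powr (1 / 100)"
  shows "eventually (\<lambda>n. 54 * x n ^ 2 \<le> n / 4) at_top"
    and "eventually (\<lambda>n. n * (exp 5 * exp (- x n / 2)) \<le> x n) at_top"
    and "eventually (\<lambda>n. 8208 * x n ^ 3 / n \<le> 1 / 132) at_top"
    and "eventually (\<lambda>n. exp 1 * (ln n * (8208 * x n ^ 3 / n)) \<le> n powr (- 1 / 20) * (1 / (36 * x n))) at_top"
    and "eventually (\<lambda>n. 2 * exp (n powr (1 / 300)) * ((1 + exp 9 * ln n) * exp (- x n / 2))
      \<le> exp (- (n powr (1 / 200)))) at_top"
    and "eventually (\<lambda>n. x n \<le> n / 4) at_top"
    and "eventually (\<lambda>n. 1 \<le> x n) at_top"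
  unfolding x_def by real_asymp+

text \<open>Amounts to e <= 4; it turns powers of 2 into exponentials that the asymptotic
  comparisons can handle.\<close>

lemma exp_half_le_power: "1 / 2 ^ m \<le> exp (- (real m / 2))"
proof -
  have "exp (1 / 2 :: real) \<le> 2"
  proof (rule power2_le_imp_le)
    show "(exp (1 / 2 :: real))\<^sup>2 \<le> 2\<^sup>2" using exp_le by (simp add: exp_double[symmetric])
  qed simp
  then have "exp (1 / 2 :: real) ^ m \<le> 2 ^ m" by (rule power_mono) simp
  then have "exp (real m / 2) \<le> 2 ^ m" by (simp add: exp_of_nat_mult[symmetric])
  then show ?thesis by (simp add: exp_minus field_simps)
qed

text \<open>Both constants can be 1: each iteration errs by about exp (- n^(1/100) / 2), so exp
  (n^(1/300)) of them still leave a total below exp (- n^(1/200)).\<close>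

theorem theorem3:
  shows "\<exists>c > 0. \<exists>c' > 0. \<exists>n0. \<forall>n \<ge> n0. \<forall>N::nat. 1 \<le> N \<and> real N < ln (real n) / 220 \<longrightarrow>
           pmf (found_within n N (G1 n) (s_star n)
                  (nat \<lfloor>exp (c' * real n powr (1/300))\<rfloor>)) True
             \<le> exp (- c * real n powr (1/200))"
proof -
  define x where "x n = n powr (1 / 100)" for n :: real
  note asym = asymptotic_bounds[folded x_def]
  have "eventually (\<lambda>n. 100 \<le> n \<and> 54 * x n ^ 2 \<le> n / 4 \<and> n * (exp 5 * exp (- x n / 2)) \<le> x n \<and>
      8208 * x n ^ 3 / n \<le> 1 / 132 \<and>
      exp 1 * (ln n * (8208 * x n ^ 3 / n)) \<le> n powr (- 1 / 20) * (1 / (36 * x n)) \<and>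
      2 * exp (n powr (1 / 300)) * ((1 + exp 9 * ln n) * exp (- x n / 2)) \<le> exp (- (n powr (1 / 200))) \<and>
      x n \<le> n / 4 \<and> 1 \<le> x n) at_top"
    using asym eventually_ge_at_top[of "100 :: real"] by (simp add: eventually_conj_iff)
  then obtain r0 where r0: "\<And>n. r0 \<le> n \<Longrightarrow> 100 \<le> n \<and> 54 * x n ^ 2 \<le> n / 4 \<and>
      n * (exp 5 * exp (- x n / 2)) \<le> x n \<and> 8208 * x n ^ 3 / n \<le> 1 / 132 \<and>
      exp 1 * (ln n * (8208 * x n ^ 3 / n)) \<le> n powr (- 1 / 20) * (1 / (36 * x n)) \<and>
      2 * exp (n powr (1 / 300)) * ((1 + exp 9 * ln n) * exp (- x n / 2)) \<le> exp (- (n powr (1 / 200))) \<and>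
      x n \<le> n / 4 \<and> 1 \<le> x n"
    unfolding eventually_at_top_linorder by blast
  have main: "pmf (found_within n N (G1 n) (s_star n) (nat \<lfloor>exp (1 * real n powr (1/300))\<rfloor>)) True
      \<le> exp (- 1 * real n powr (1/200))"
    if n: "nat \<lceil>r0\<rceil> \<le> n" and N: "1 \<le> N" and NL: "real N < ln (real n) / 220" for n N
  proof -
    let ?n = "real n" and ?x = "x (real n)"
    have "r0 \<le> ?n" using n by linarith
    from r0[OF this] have n100: "100 \<le> ?n" and a1: "54 * ?x ^ 2 \<le> ?n / 4"
      and a2: "?n * (exp 5 * exp (- ?x / 2)) \<le> ?x" and a3: "8208 * ?x ^ 3 / ?n \<le> 1 / 132"
      and a4: "exp 1 * (ln ?n * (8208 * ?x ^ 3 / ?n)) \<le> ?n powr (- 1 / 20) * (1 / (36 * ?x))"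
      and a5: "2 * exp (?n powr (1 / 300)) * ((1 + exp 9 * ln ?n) * exp (- ?x / 2)) \<le> exp (- (?n powr (1 / 200)))"
      and a6: "?x \<le> ?n / 4" and x1: "1 \<le> ?x" by blast+
    have nn: "100 \<le> n" "10 \<le> n" "3 \<le> n" using n100 by linarith+
    have ln0: "0 \<le> ln ?n" using n100 by simp
    have Nln: "real N \<le> ln ?n" using NL ln0 by linarith
    define L where "L = nat \<lceil>?x\<rceil>"
    \<comment> \<open>Chosen so that \<open>l * (K - 9 * L)\<close> is exactly
      \<open>L\<close>.\<close>
    define K where "K = 9 * L + 9 * L\<^sup>2"
    define l where "l = 1 / (9 * real L)"
    define \<tau> where "\<tau> = 8 * real K * (9 * real L + ?n * (exp 5 / 2 ^ L)) / ?n"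
    define \<delta> where "\<delta> = exp (- l * (real K - 9 * real L)) + real N * (exp 5 / 2 ^ L)"
    have xL: "?x \<le> real L" "real L \<le> 2 * ?x" using x1 unfolding L_def by linarith+
    have L1: "1 \<le> L" using xL x1 by linarith
    have l0: "0 < l" "l \<le> 1" using L1 by (auto simp: l_def)
    have "real K = 9 * real L + 9 * (real L)\<^sup>2" by (simp add: K_def)
    \<comment> \<open>\<open>1 \<le> ?x\<close> makes the linear term quadratic; 18 + 36 =
      54.\<close>
    also have "\<dots> \<le> 9 * (2 * ?x) * ?x + 9 * (2 * ?x)\<^sup>2"
      using xL x1 mult_mono[of "real L" "2 * ?x" 1 ?x] by (intro add_mono mult_left_mono power_mono) auto
    also have "\<dots> = 54 * ?x ^ 2" by (simp add: power2_eq_square)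
    finally have K: "real K \<le> 54 * ?x ^ 2" .
    have lK: "l * (real K - 9 * real L) = real L"
      using L1 by (simp add: l_def K_def power2_eq_square)
    have "exp (- (real L / 2)) \<le> exp (- ?x / 2)" using xL by simp
    then have pL: "1 / 2 ^ L \<le> exp (- ?x / 2)" using exp_half_le_power[of L] by linarith
    have "?n * (exp 5 / 2 ^ L) = ?n * (exp 5 * (1 / 2 ^ L))" by simp
    also have "\<dots> \<le> ?n * (exp 5 * exp (- ?x / 2))" using pL by (intro mult_left_mono) auto
    finally have nL: "?n * (exp 5 / 2 ^ L) \<le> ?x" using a2 by linarith
    \<comment> \<open>19 = 18 + 1: 9L is at most 18 \<open>?x\<close>, and the truncation error at
      most \<open>?x\<close>.\<close>
    have "8 * real K * (9 * real L + ?n * (exp 5 / 2 ^ L)) \<le> 8 * (54 * ?x ^ 2) * (19 * ?x)"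
      using K nL xL x1 by (intro mult_mono) auto
    also have "\<dots> = 8208 * ?x ^ 3" by (simp add: power2_eq_square power3_eq_cube)
    finally have \<tau>x: "\<tau> \<le> 8208 * ?x ^ 3 / ?n" unfolding \<tau>_def by (rule divide_right_mono) simp
    have \<tau>1: "\<tau> \<le> 1 / 132" using \<tau>x a3 by linarith
    \<comment> \<open>The sample bound is used here: 220 = 20 * 11, and below exp (- 11) <= 2^(-11)
      <= 1/44 = 1/33 - 1/132.\<close>
    have "?n powr (- 1 / 20) = exp (- (11 * (ln ?n / 220)))" using n100 by (simp add: powr_def)
    also have "\<dots> \<le> exp (- (11 * real N))" using NL by simp
    also have "\<dots> = exp (- 11) ^ N" by (simp add: exp_of_nat_mult[symmetric] mult.commute)
    also have "\<dots> \<le> (1 / 33 - \<tau>) ^ N"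
    proof (rule power_mono)
      have "(2::real) ^ 11 \<le> exp 1 ^ 11"
        using exp_ge_add_one_self[of "1::real"] by (intro power_mono) auto
      then have "44 \<le> exp (11 :: real)" by (simp add: exp_of_nat_mult[symmetric])
      then have "exp (- 11 :: real) \<le> 1 / 44" by (simp add: exp_minus field_simps)
      then show "exp (- 11) \<le> 1 / 33 - \<tau>" using \<tau>1 by linarith
    qed simp
    finally have p: "?n powr (- 1 / 20) \<le> (1 / 33 - \<tau>) ^ N" .
    \<comment> \<open>Lower bound for the relative gain from one lost edge; its last link is exp l
      >= 1 + l.\<close>
    have "1 / (36 * ?x) \<le> 1 / (18 * real L)" using xL L1 by (intro divide_left_mono) auto
    also have "\<dots> = l / 2" by (simp add: l_def)
    also have "\<dots> \<le> l / (1 + l)" using l0 by (intro divide_left_mono) auto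
    also have "\<dots> = 1 - 1 / (1 + l)" using l0 by (simp add: field_simps)
    also have "\<dots> \<le> 1 - exp (- l)"
      using exp_ge_add_one_self[of l] l0 by (simp add: exp_minus inverse_eq_divide frac_le)
    finally have e: "1 / (36 * ?x) \<le> 1 - exp (- l)" .
    have \<tau>0: "0 \<le> \<tau>" unfolding \<tau>_def by simp
    have "exp 1 * (real N * \<tau>) \<le> exp 1 * (ln ?n * (8208 * ?x ^ 3 / ?n))"
      using Nln \<tau>x \<tau>0 ln0 by (intro mult_left_mono mult_mono) auto
    also have "\<dots> \<le> ?n powr (- 1 / 20) * (1 / (36 * ?x))" by (rule a4)
    also have "\<dots> \<le> (1 / 33 - \<tau>) ^ N * (1 - exp (- l))"
      using p e x1 \<tau>1 by (intro mult_mono) auto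
    finally have \<tau>2: "exp 1 * (real N * \<tau>) \<le> (1 / 33 - \<tau>) ^ N * (1 - exp (- l))" .
    have \<tau>3: "\<tau> \<le> 1 / 33" using \<tau>1 by linarith
    have drift: "measure_pmf.expectation (iter_best n N (G1 n) (PiH n H)) (potential l n)
        \<le> potential l n H + \<delta>" if H: "ham_cycle n H" for H
    proof -
      obtain h where "ham n h H" using ham_cycle_ham[OF H nn(3)] by blast
      then interpret ham n h H .
      show ?thesis unfolding \<delta>_def by (rule drift[OF nn(1) N L1 l_def \<tau>_def \<tau>3 \<tau>2])
    qed
    have \<delta>0: "0 \<le> \<delta>" unfolding \<delta>_def by simp
    \<comment> \<open>A common bound for the initial potential and for \<delta>, so that
      \<open>T\<close> iterations cost (1 + T) b; \<open>exp 9\<close> from the uniform start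
      dominates the \<open>exp 5\<close> of the later iterations.\<close>
    define b where "b = (1 + exp 9 * ln ?n) * exp (- ?x / 2)"
    have e59: "exp 5 \<le> exp (9::real)" by simp
    have bsum: "exp (- ?x / 2) + ln ?n * (exp 9 * exp (- ?x / 2)) = b" by (simp add: b_def algebra_simps)
    have "\<delta> \<le> b"
    proof -
      have "exp (- l * (real K - 9 * real L)) \<le> exp (- ?x / 2)" using lK xL x1 by simp
      moreover have "real N * (exp 5 / 2 ^ L) \<le> ln ?n * (exp 9 * exp (- ?x / 2))"
        using Nln pL e59 mult_mono[of "exp 5" "exp (9::real)" "1 / 2 ^ L" "exp (- ?x / 2)"]
        by (intro mult_mono) auto
      ultimately show ?thesis unfolding \<delta>_def using bsum by linarith
    qed
    moreover have "measure_pmf.expectation (iter_best n N (G1 n) (Pi0 n)) (potential l n) \<le> b"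
    proof -
      let ?m = "n - K - n div 2"
      have "measure_pmf.expectation (iter_best n N (G1 n) (Pi0 n)) (potential l n)
          \<le> exp (- l * real K) + real N * (exp 9 / 2 ^ ?m)"
        using l0 by (intro initial_potential[OF nn(2) N]) simp
      also have "\<dots> \<le> exp (- ?x / 2) + ln ?n * (exp 9 * exp (- ?x / 2))"
      proof (rule add_mono)
        have "l * (real K - 9 * real L) \<le> l * real K" using l0 by (intro mult_left_mono) auto
        then have "real L \<le> l * real K" using lK by linarith
        then show "exp (- l * real K) \<le> exp (- ?x / 2)" using xL x1 by simp
        \<comment> \<open>\<open>K\<close> is at most n/4, so a quarter of the edges remains as
          exponent for the uniform sample.\<close>
        have "real n / 4 \<le> real ?m" using K a1 by linarith
        then have "exp (- (real ?m / 2)) \<le> exp (- ?x / 2)" using a6 by simp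
        then have "1 / 2 ^ ?m \<le> exp (- ?x / 2)" using exp_half_le_power[of ?m] by linarith
        then show "real N * (exp 9 / 2 ^ ?m) \<le> ln ?n * (exp 9 * exp (- ?x / 2))"
          using Nln mult_left_mono[of "1 / 2 ^ ?m" "exp (- ?x / 2)" "exp 9"] by (intro mult_mono) auto
      qed
      finally show ?thesis using bsum by simp
    qed
    moreover have "pmf (found_within n N (G1 n) (s_star n) T) True
        \<le> measure_pmf.expectation (iter_best n N (G1 n) (Pi0 n)) (potential l n) + real T * \<delta>" for T
      unfolding found_within_def
      by (rule found_from_le[OF nn(3) N less_imp_le[OF l0(1)] \<delta>0 gen_Pi0[OF nn(3)] drift])
    ultimately have "pmf (found_within n N (G1 n) (s_star n) T) True \<le> b + real T * b" for T
      by (meson add_mono mult_left_mono of_nat_0_le_iff order_trans)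
    from this[of "nat \<lfloor>exp (1 * ?n powr (1/300))\<rfloor>"]
    have "pmf (found_within n N (G1 n) (s_star n) (nat \<lfloor>exp (1 * ?n powr (1/300))\<rfloor>)) True
        \<le> (1 + real (nat \<lfloor>exp (1 * ?n powr (1/300))\<rfloor>)) * b" by (simp add: algebra_simps)
    also have "\<dots> \<le> (2 * exp (?n powr (1/300))) * b"
    proof (rule mult_right_mono)
      have "real (nat \<lfloor>exp (1 * ?n powr (1/300))\<rfloor>) \<le> exp (?n powr (1/300))"
        by (simp add: of_nat_floor)
      moreover have "1 \<le> exp (?n powr (1/300))" by simp
      ultimately show "1 + real (nat \<lfloor>exp (1 * ?n powr (1/300))\<rfloor>) \<le> 2 * exp (?n powr (1/300))" by linarith
      show "0 \<le> b" using ln0 by (simp add: b_def)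
    qed
    also have "\<dots> \<le> exp (- 1 * ?n powr (1/200))" using a5 by (simp add: b_def)
    finally show ?thesis .
  qed
  show ?thesis
    by (rule exI[of _ 1], intro conjI, simp, rule exI[of _ 1], intro conjI, simp,
        rule exI[of _ "nat \<lceil>r0\<rceil>"]) (use main in blast)
qed

end
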